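(* A Hamiltonian graph $G$ is planar if and only if its Hamiltonian level number is at most 2, i.e. $h\ell(G)\le 2$. Moreover, a Hamiltonian graph $G$ is outerplanar if and only if its Hamiltonian level number is 1, i.e. $h\ell(G)=1$.
   Context: All graphs are connected, undirected, simple and finite. A graph is Hamiltonian if it contains a cycle that visits every vertex exactly once. A graph is planar if it has an embedding on a sphere or a plane, and outerplanar if it can be embedded on the sphere such that all vertices lie on the boundary of one region. A graph embedding is an embedding $G\to S^3$ of a graph $G$, up to ambient isotopy; the spatial graph $\mathcal{G}$ is its image up to ambient isotopy. A cycle is unknotted if it can be embedded as the equator of a sphere $S^2$. The fragments of a graph $G$ with respect to a cycle $C$ are the closures of the connected components of $G-C$ (so an edge not in $C$ with both endpoints on $C$ is a fragment). A diagram of $\mathcal{G}$ is the image of a projection of $\mathcal{G}$ to $\mathbb{R}^2$ such that all intersections are transversal, no vertices and at most two points are mapped to a crossing, and each double point is assigned as an over- or under-crossing. It is reduced if no Reidemeister moves of type 1 and 2 can be applied to reduce its number of crossings. $\mathcal{G}$ is semi-leveled if there is an unknotted cycle $C$ (the spine) and a diagram $D$ of $\mathcal{G}$ (a semi-leveled diagram) in which no fragment with respect to $C$ has self-crossings, crossings with $C$, or both over- and under-crossings with another fragment. A reduced semi-leveled diagram in which every fragment lies in the bounded connected component of $\mathbb{R}^2\setminus C$ is divided in levels if there is a partition $\{L_1,\dots,L_n\}$ of all the fragments such that $L_1$ is the set of fragments that do not cross over any other fragment, and for $i>1$ the set $L_i$ consists of the fragments that cross over at least one fragment in $L_{i-1}$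 and only cross over fragments in sets $L_k$ with $k<i$; then $n$ is the number of levels. A connected spatial graph is leveled (with spine $C$) if it has a semi-leveled diagram (with spine $C$) that is divided in levels; it is Hamiltonian leveled if the spine is a Hamiltonian cycle of the underlying graph. The Hamiltonian level number $h\ell(\mathcal{G})$ of a Hamiltonian spatial graph is the minimum number of levels of $\mathcal{G}$ ranging over all choices of Hamiltonian spines for a Hamiltonian leveled embedding of $\mathcal{G}$. The Hamiltonian level number $h\ell(G)$ of an abstract Hamiltonian graph $G$ is the minimum Hamiltonian level number of all its embeddings. *)

theory Defs
  imports "HOL-Analysis.Analysis" "HOL-Library.Extended_Nat"
begin

section \<open>Graphs\<close>

definition simple_graph :: "'a set \<Rightarrow> 'a set set \<Rightarrow> bool" where
  "simple_graph V E \<longleftrightarrow> finite V \<and> (\<forall>e\<in>E. e \<subseteq> V \<and> card e = 2)"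

definition connected_graph :: "'a set \<Rightarrow> 'a set set \<Rightarrow> bool" where
  "connected_graph V E \<longleftrightarrow> (\<forall>u\<in>V. \<forall>v\<in>V. (u, v) \<in> {(a, b). {a, b} \<in> E}\<^sup>*)"

text \<open>A cycle is given by the list of its vertices in cyclic order.\<close>

definition cycle_edges :: "'a list \<Rightarrow> 'a set set" where
  "cycle_edges c = {{c ! i, c ! (Suc i mod length c)} | i. i < length c}"

definition is_cycle :: "'a set \<Rightarrow> 'a set set \<Rightarrow> 'a list \<Rightarrow> bool" where
  "is_cycle V E c \<longleftrightarrow> length c \<ge> 3 \<and> distinct c \<and> set c \<subseteq> V \<and> cycle_edges c \<subseteq> E"

definition hamiltonian_cycle :: "'a set \<Rightarrow> 'a set set \<Rightarrow> 'a list \<Rightarrow> bool" where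
  "hamiltonian_cycle V E c \<longleftrightarrow> is_cycle V E c \<and> set c = V"

definition hamiltonian :: "'a set \<Rightarrow> 'a set set \<Rightarrow> bool" where
  "hamiltonian V E \<longleftrightarrow> (\<exists>c. hamiltonian_cycle V E c)"


section \<open>Embedded graphs\<close>

text \<open>An embedding of the graph into \<open>X\<close> consists of a placement \<open>p\<close> of the vertices and, for
  each edge \<open>e\<close>, an arc \<open>g e\<close> in \<open>X\<close> joining the images of the two ends of \<open>e\<close>. Vertices and
  edges meet only where this is forced by incidence.\<close>

definition graph_embedding ::
  "'a set \<Rightarrow> 'a set set \<Rightarrow> 'b::topological_space set \<Rightarrow> ('a \<Rightarrow> 'b) \<Rightarrow> ('a set \<Rightarrow> real \<Rightarrow> 'b) \<Rightarrow> bool"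
where
  "graph_embedding V E X p g \<longleftrightarrow>
     inj_on p V \<and> p ` V \<subseteq> X \<and>
     (\<forall>e\<in>E. arc (g e) \<and> path_image (g e) \<subseteq> X \<and> {pathstart (g e), pathfinish (g e)} = p ` e) \<and>
     (\<forall>e\<in>E. \<forall>v\<in>V. p v \<in> path_image (g e) \<longrightarrow> v \<in> e) \<and>
     (\<forall>e\<in>E. \<forall>e'\<in>E. e \<noteq> e' \<longrightarrow> path_image (g e) \<inter> path_image (g e') \<subseteq> p ` (e \<inter> e'))"

definition graph_image :: "'a set \<Rightarrow> 'a set set \<Rightarrow> ('a \<Rightarrow> 'b) \<Rightarrow> ('a set \<Rightarrow> real \<Rightarrow> 'b::topological_space) \<Rightarrow> 'b set"
where
  "graph_image V E p g = p ` V \<union> (\<Union>e\<in>E. path_image (g e))"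

definition cycle_image :: "('a set \<Rightarrow> real \<Rightarrow> 'b::topological_space) \<Rightarrow> 'a list \<Rightarrow> 'b set" where
  "cycle_image g c = (\<Union>e\<in>cycle_edges c. path_image (g e))"

text \<open>The plane is \<^typ>\<open>complex\<close>, Euclidean 3-space is \<^typ>\<open>complex \<times> real\<close>, with \<^const>\<open>fst\<close> the
  vertical projection to the plane and \<^const>\<open>snd\<close> the height.\<close>

type_synonym space3 = "complex \<times> real"
type_synonym space4 = "space3 \<times> real"

abbreviation sphere2 :: "space3 set" where "sphere2 \<equiv> sphere 0 1"
abbreviation sphere3 :: "space4 set" where "sphere3 \<equiv> sphere 0 1"

definition planar :: "'a set \<Rightarrow> 'a set set \<Rightarrow> bool" where
  "planar V E \<longleftrightarrow>
     (\<exists>p g. graph_embedding V E (UNIV :: complex set) p g) \<or>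
     (\<exists>p g. graph_embedding V E sphere2 p g)"

definition outerplanar :: "'a set \<Rightarrow> 'a set set \<Rightarrow> bool" where
  "outerplanar V E \<longleftrightarrow>
     (\<exists>p g. graph_embedding V E sphere2 p g \<and>
       (\<exists>R\<in>components (sphere2 - graph_image V E p g).
          p ` V \<subseteq> top_of_set sphere2 frontier_of R))"


section \<open>Spatial graphs\<close>

text \<open>\<open>h\<close> is the final stage of an ambient isotopy of the 3-sphere.\<close>

definition ambient_isotopy_end :: "(space4 \<Rightarrow> space4) \<Rightarrow> bool" where
  "ambient_isotopy_end h \<longleftrightarrow>
     homotopic_with (homeomorphic_map (top_of_set sphere3) (top_of_set sphere3))
       (top_of_set sphere3) (top_of_set sphere3) id h"

definition ambient_isotopic ::
  "'a set \<Rightarrow> 'a set set \<Rightarrow> ('a \<Rightarrow> space4) \<Rightarrow> ('a set \<Rightarrow> real \<Rightarrow> space4) \<Rightarrow>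
   ('a \<Rightarrow> space4) \<Rightarrow> ('a set \<Rightarrow> real \<Rightarrow> space4) \<Rightarrow> bool" where
  "ambient_isotopic V E p g p' g' \<longleftrightarrow>
     (\<exists>h. ambient_isotopy_end h \<and> (\<forall>v\<in>V. h (p v) = p' v) \<and>
          (\<forall>e\<in>E. h ` path_image (g e) = path_image (g' e)))"

text \<open>The model 2-sphere is \<open>{((z, r), t) \<in> sphere3. t = 0}\<close>; its equator is where \<open>r = 0\<close>.\<close>

definition unknotted :: "space4 set \<Rightarrow> bool" where
  "unknotted K \<longleftrightarrow> (\<exists>h. ambient_isotopy_end h \<and> h ` K = {((z, 0), 0) | z. cmod z = 1})"

text \<open>Inverse stereographic projection, identifying 3-space with the 3-sphere minus the
  point \<open>(0, 1)\<close>.\<close>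

definition inv_stereographic :: "space3 \<Rightarrow> space4" where
  "inv_stereographic x =
     ((2 / ((norm x)\<^sup>2 + 1)) *\<^sub>R x, ((norm x)\<^sup>2 - 1) / ((norm x)\<^sup>2 + 1))"


section \<open>Diagrams\<close>

text \<open>A diagram is given by an embedding \<open>(p, g)\<close> into 3-space whose vertical projection is
  regular. Its crossings are the pairs of distinct points of the embedded graph lying over the
  same point of the plane; the higher of the two is the over-crossing.\<close>

definition crosses_over :: "space3 set \<Rightarrow> space3 set \<Rightarrow> bool" where
  "crosses_over A B \<longleftrightarrow> (\<exists>x\<in>A. \<exists>y\<in>B. fst x = fst y \<and> snd x > snd y)"

text \<open>Two planar curves meet transversally at parameters \<open>s\<close> and \<open>t\<close> if, in a suitable local
  chart, strands around these parameters become the two coordinate axes of the unit disc.\<close>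

definition transversal :: "(real \<Rightarrow> complex) \<Rightarrow> real \<Rightarrow> (real \<Rightarrow> complex) \<Rightarrow> real \<Rightarrow> bool" where
  "transversal f s f' t \<longleftrightarrow>
     (\<exists>U \<phi> \<psi> a b c d. open U \<and> homeomorphism U (ball 0 1) \<phi> \<psi> \<and>
        0 \<le> a \<and> a < s \<and> s < b \<and> b \<le> 1 \<and> 0 \<le> c \<and> c < t \<and> t < d \<and> d \<le> 1 \<and>
        f s = \<psi> 0 \<and> f' t = \<psi> 0 \<and>
        f ` {a<..<b} = \<psi> ` {z \<in> ball 0 1. Im z = 0} \<and>
        f' ` {c<..<d} = \<psi> ` {z \<in> ball 0 1. Re z = 0})"

definition is_diagram ::
  "'a set \<Rightarrow> 'a set set \<Rightarrow> ('a \<Rightarrow> space3) \<Rightarrow> ('a set \<Rightarrow> real \<Rightarrow> space3) \<Rightarrow> bool" where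
  "is_diagram V E p g \<longleftrightarrow>
     graph_embedding V E UNIV p g \<and>
     finite {fst x | x y. x \<in> graph_image V E p g \<and> y \<in> graph_image V E p g \<and>
                          x \<noteq> y \<and> fst x = fst y} \<and>
     (\<forall>v\<in>V. \<forall>x\<in>graph_image V E p g. fst x = fst (p v) \<longrightarrow> x = p v) \<and>
     (\<forall>x\<in>graph_image V E p g. \<forall>y\<in>graph_image V E p g. \<forall>z\<in>graph_image V E p g.
        fst x = fst y \<and> fst y = fst z \<longrightarrow> x = y \<or> y = z \<or> x = z) \<and>
     (\<forall>e\<in>E. \<forall>e'\<in>E. \<forall>s\<in>{0..1}. \<forall>t\<in>{0..1}.
        g e s \<noteq> g e' t \<and> fst (g e s) = fst (g e' t) \<longrightarrow>
        transversal (fst \<circ> g e) s (fst \<circ> g e') t)"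

text \<open>A crossing-reducing move of type 1 removes an empty loop of a single edge. A
  crossing-reducing move of type 2 removes an empty bigon between two edge segments (possibly of
  the same edge), one of which passes over the other at both corners. Emptiness also excludes
  further strands crossing the sides, since these would enter the bounded region transversally.\<close>

definition reducing_move_1 ::
  "'a set \<Rightarrow> 'a set set \<Rightarrow> ('a \<Rightarrow> space3) \<Rightarrow> ('a set \<Rightarrow> real \<Rightarrow> space3) \<Rightarrow> bool" where
  "reducing_move_1 V E p g \<longleftrightarrow>
     (\<exists>e\<in>E. \<exists>s t. 0 \<le> s \<and> s < t \<and> t \<le> 1 \<and> fst (g e s) = fst (g e t) \<and>
        simple_path (subpath s t (fst \<circ> g e)) \<and>
        inside (path_image (subpath s t (fst \<circ> g e))) \<inter> fst ` graph_image V E p g = {})"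

definition reducing_move_2 ::
  "'a set \<Rightarrow> 'a set set \<Rightarrow> ('a \<Rightarrow> space3) \<Rightarrow> ('a set \<Rightarrow> real \<Rightarrow> space3) \<Rightarrow> bool" where
  "reducing_move_2 V E p g \<longleftrightarrow>
     (\<exists>e\<in>E. \<exists>e'\<in>E. \<exists>s\<in>{0..1}. \<exists>t\<in>{0..1}. \<exists>s'\<in>{0..1}. \<exists>t'\<in>{0..1}.
        let a = subpath s t (fst \<circ> g e); b = subpath s' t' (fst \<circ> g e') in
        fst (g e s) = fst (g e' s') \<and> snd (g e s) > snd (g e' s') \<and>
        fst (g e t) = fst (g e' t') \<and> snd (g e t) > snd (g e' t') \<and>
        arc a \<and> arc b \<and> path_image a \<inter> path_image b = {pathstart a, pathfinish a} \<and>
        inside (path_image a \<union> path_image b) \<inter> fst ` graph_image V E p g = {})"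

definition reduced ::
  "'a set \<Rightarrow> 'a set set \<Rightarrow> ('a \<Rightarrow> space3) \<Rightarrow> ('a set \<Rightarrow> real \<Rightarrow> space3) \<Rightarrow> bool" where
  "reduced V E p g \<longleftrightarrow> \<not> reducing_move_1 V E p g \<and> \<not> reducing_move_2 V E p g"


section \<open>Leveled spatial graphs\<close>

definition fragments ::
  "'a set \<Rightarrow> 'a set set \<Rightarrow> ('a \<Rightarrow> space3) \<Rightarrow> ('a set \<Rightarrow> real \<Rightarrow> space3) \<Rightarrow> 'a list \<Rightarrow> space3 set set"
where
  "fragments V E p g c = closure ` components (graph_image V E p g - cycle_image g c)"

definition semi_leveled_diagram ::
  "'a set \<Rightarrow> 'a set set \<Rightarrow> ('a \<Rightarrow> space3) \<Rightarrow> ('a set \<Rightarrow> real \<Rightarrow> space3) \<Rightarrow> 'a list \<Rightarrow> bool" where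
  "semi_leveled_diagram V E p g c \<longleftrightarrow>
     is_diagram V E p g \<and> is_cycle V E c \<and>
     unknotted (inv_stereographic ` cycle_image g c) \<and>
     (\<forall>A\<in>fragments V E p g c.
        \<not> crosses_over A A \<and>
        \<not> crosses_over A (cycle_image g c) \<and> \<not> crosses_over (cycle_image g c) A \<and>
        (\<forall>B\<in>fragments V E p g c. B \<noteq> A \<longrightarrow> \<not> (crosses_over A B \<and> crosses_over B A)))"

text \<open>The first level may be empty only if there are no fragments at all; a diagram consisting
  of the spine alone has one level.\<close>

definition level_partition :: "space3 set set \<Rightarrow> nat \<Rightarrow> (nat \<Rightarrow> space3 set set) \<Rightarrow> bool" where
  "level_partition F n L \<longleftrightarrow>
     n \<ge> 1 \<and> (\<Union>i\<in>{1..n}. L i) = F \<and> disjoint_family_on L {1..n} \<and>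
     (\<forall>i\<in>{2..n}. L i \<noteq> {}) \<and>
     L 1 = {A \<in> F. \<forall>B\<in>F. B \<noteq> A \<longrightarrow> \<not> crosses_over A B} \<and>
     (\<forall>i\<in>{2..n}. L i = {A \<in> F. (\<exists>B\<in>L (i - 1). crosses_over A B) \<and>
                               (\<forall>B\<in>F. crosses_over A B \<longrightarrow> (\<exists>k\<in>{1..<i}. B \<in> L k))})"

text \<open>For the complement of the projected spine to have a unique bounded component, the spine
  must not cross itself; that component is then the \<^const>\<open>inside\<close> of the projected spine.\<close>

definition divided_in_levels ::
  "'a set \<Rightarrow> 'a set set \<Rightarrow> ('a \<Rightarrow> space3) \<Rightarrow> ('a set \<Rightarrow> real \<Rightarrow> space3) \<Rightarrow> 'a list \<Rightarrow> nat \<Rightarrow> bool" where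
  "divided_in_levels V E p g c n \<longleftrightarrow>
     semi_leveled_diagram V E p g c \<and> reduced V E p g \<and>
     \<not> crosses_over (cycle_image g c) (cycle_image g c) \<and>
     (\<forall>A\<in>fragments V E p g c. fst ` (A - cycle_image g c) \<subseteq> inside (fst ` cycle_image g c)) \<and>
     (\<exists>L. level_partition (fragments V E p g c) n L)"

text \<open>The spatial graph \<open>(p, g)\<close> in the 3-sphere has a leveled diagram with spine \<open>c\<close> and \<open>n\<close>
  levels.\<close>

definition leveled ::
  "'a set \<Rightarrow> 'a set set \<Rightarrow> ('a \<Rightarrow> space4) \<Rightarrow> ('a set \<Rightarrow> real \<Rightarrow> space4) \<Rightarrow> 'a list \<Rightarrow> nat \<Rightarrow> bool" where
  "leveled V E p g c n \<longleftrightarrow>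
     (\<exists>q k. divided_in_levels V E q k c n \<and>
        ambient_isotopic V E p g (inv_stereographic \<circ> q) (\<lambda>e. inv_stereographic \<circ> k e))"

text \<open>The level numbers are minima in \<^typ>\<open>enat\<close>; the value \<open>\<infinity>\<close> means that there is no
  Hamiltonian leveled diagram (for instance for wild embeddings).\<close>

definition spatial_hamiltonian_level_number ::
  "'a set \<Rightarrow> 'a set set \<Rightarrow> ('a \<Rightarrow> space4) \<Rightarrow> ('a set \<Rightarrow> real \<Rightarrow> space4) \<Rightarrow> enat" where
  "spatial_hamiltonian_level_number V E p g =
     Inf {enat n | n c. hamiltonian_cycle V E c \<and> leveled V E p g c n}"

definition hamiltonian_level_number :: "'a set \<Rightarrow> 'a set set \<Rightarrow> enat" where
  "hamiltonian_level_number V E =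
     Inf {spatial_hamiltonian_level_number V E p g | p g. graph_embedding V E sphere3 p g}"

end

theory Submission
  imports Defs
begin

text \<open>
  Fix a Hamiltonian cycle, the spine. Every other edge is a chord, and two chords interleave if
  their ends alternate along the spine. Both equivalences go through a combinatorial condition:
  the graph has level number at most 2, and is planar, exactly if the chords can be
  distributed over two pages (sets without interleaving chords); it has level number 1, and is outerplanar, exactly if
  one page suffices.

  That pages are necessary is a matter of separation. A chord drawn inside a closed curve cuts
  the inside in two, and a connected set in the inside that avoids the chord cannot accumulate at
  interior points of both arcs into which the ends of the chord divide the curve
  (\<open>chord_separates_in_plane\<close>). Hence two disjoint chords on the same
  side of the spine never interleave. On the sphere, each side of the spine becomes a set
  inside a plane curve after projection from a point on the other side (\<open>sides_on_sphere\<close>), so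
  the two sides of a planar embedding are the two pages (\<open>sphere_embedding_two_page\<close>). In an
  outerplanar embedding the region that touches all vertices is itself such a connected set, so
  chords that interleave would all lie on the side opposite to it, where they cannot be disjoint
  (\<open>outerplanar_one_page\<close>). In a
  diagram, the fragments of a Hamiltonian spine are precisely the chords
  (\<open>fragments_eq_chords\<close>), and fragments of one level do not cross (\<open>same_level_noncrossing\<close>),
  so they project to disjoint chords inside the projected spine, and every level is a page.

  That pages are sufficient follows from one explicit model. Put the vertices at the corners of a
  regular polygon on the equator of the unit sphere, run the spine along the equator, and lift the
  straight diagonals to the lower or the upper hemisphere according to their page. As a subset of
  the sphere this is a planar embedding (\<open>hemi_embedding\<close>), and an outerplanar one if the upper
  hemisphere stays empty (\<open>hemi_outerplanar\<close>). As a spatial graph it is a leveled diagram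
  (\<open>hemi_divided\<close>): its vertical projection is the drawing with straight diagonals, in which two
  chords cross at most once and transversally, and the upper chords always pass over the lower
  ones. This way no curve has to be straightened and no topological disc has to be
  parametrised: only the separation statement is needed for arbitrary embeddings.
\<close>

section \<open>Graph embeddings\<close>

lemma graph_embeddingD:
  assumes "graph_embedding V E X p g"
  shows "inj_on p V" "p ` V \<subseteq> X"
    and "e \<in> E \<Longrightarrow> arc (g e)" "e \<in> E \<Longrightarrow> path_image (g e) \<subseteq> X"
      "e \<in> E \<Longrightarrow> {pathstart (g e), pathfinish (g e)} = p ` e"
    and "\<lbrakk>e \<in> E; u \<in> V; p u \<in> path_image (g e)\<rbrakk> \<Longrightarrow> u \<in> e"
    and "\<lbrakk>e \<in> E; f \<in> E; e \<noteq> f\<rbrakk> \<Longrightarrow> path_image (g e) \<inter> path_image (g f) \<subseteq> p ` (e \<inter> f)"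
proof -
  note * = assms[unfolded graph_embedding_def]
  note edge = bspec[OF conjunct1[OF conjunct2[OF conjunct2[OF *]]]]
  show "e \<in> E \<Longrightarrow> arc (g e)" "e \<in> E \<Longrightarrow> path_image (g e) \<subseteq> X"
    "e \<in> E \<Longrightarrow> {pathstart (g e), pathfinish (g e)} = p ` e"
    using edge by simp_all
  show "inj_on p V" "p ` V \<subseteq> X"
    and "\<lbrakk>e \<in> E; u \<in> V; p u \<in> path_image (g e)\<rbrakk> \<Longrightarrow> u \<in> e"
    and "\<lbrakk>e \<in> E; f \<in> E; e \<noteq> f\<rbrakk> \<Longrightarrow> path_image (g e) \<inter> path_image (g f) \<subseteq> p ` (e \<inter> f)"
    using * by simp_all
qed

lemma graph_embedding_mono:
  "\<lbrakk>graph_embedding V E X p g; E' \<subseteq> E; \<And>e. e \<in> E' \<Longrightarrow> path_image (g e) \<subseteq> Y; p ` V \<subseteq> Y\<rbrakk>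
    \<Longrightarrow> graph_embedding V E' Y p g"
  unfolding graph_embedding_def by (intro conjI ballI impI) (simp_all add: subset_iff)

lemma graph_embedding_image:
  assumes emb: "graph_embedding V E X p g" and h: "continuous_on X h" "inj_on h X"

  shows "graph_embedding V E (h ` X) (h \<circ> p) (\<lambda>e. h \<circ> g e)"
proof -
  note * = graph_embeddingD[OF emb]
  have pX: "p u \<in> X" if "u \<in> V" for u using *(2) that by blast
  note gX = *(4)
  show ?thesis unfolding graph_embedding_def
  proof (intro conjI ballI impI)
    show "inj_on (h \<circ> p) V" using *(1,2) h by (meson comp_inj_on inj_on_subset)
    show "(h \<circ> p) ` V \<subseteq> h ` X" using pX by auto
  next
    fix e assume e: "e \<in> E"
    show "arc (h \<circ> g e)" 
    proof -
      have "continuous_on (path_image (g e)) h" "inj_on h (path_image (g e))"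
        using gX[OF e] h by (meson continuous_on_subset inj_on_subset)+
      then show ?thesis using *(3)[OF e] unfolding arc_def
        by (auto intro: path_continuous_image comp_inj_on simp: path_image_def)
    qed
    show "path_image (h \<circ> g e) \<subseteq> h ` X" using gX[OF e] by (auto simp: path_image_compose)
    have "{pathstart (g e), pathfinish (g e)} = p ` e" by (rule *(5)[OF e])
    then have "h ` {pathstart (g e), pathfinish (g e)} = h ` p ` e" by simp
    then show "{pathstart (h \<circ> g e), pathfinish (h \<circ> g e)} = (h \<circ> p) ` e"
      by (simp add: pathstart_compose pathfinish_compose image_comp)
    fix u assume u: "u \<in> V" "(h \<circ> p) u \<in> path_image (h \<circ> g e)"
    then have "p u \<in> path_image (g e)"
      using inj_on_image_mem_iff[OF h(2) pX[OF u(1)] gX[OF e]] by (simp add: path_image_compose)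
    then show "u \<in> e" by (rule *(6)[OF e u(1)])
  next
    fix e f assume ef: "e \<in> E" "f \<in> E" "e \<noteq> f"
    have "path_image (h \<circ> g e) \<inter> path_image (h \<circ> g f) = h ` (path_image (g e) \<inter> path_image (g f))"
      using inj_on_image_Int[OF h(2) gX[OF ef(1)] gX[OF ef(2)]] by (simp add: path_image_compose)
    also have "\<dots> \<subseteq> h ` p ` (e \<inter> f)" by (intro image_mono *(7) ef)
    finally show "path_image (h \<circ> g e) \<inter> path_image (h \<circ> g f) \<subseteq> (h \<circ> p) ` (e \<inter> f)"
      by (simp add: image_comp)
  qed
qed

section \<open>Vertices along a Hamiltonian cycle\<close>

text \<open>Cyclic indexing: positions beyond the end of the list wrap around, so that an arc of the
  cycle is an interval of indices even if it passes the start of the list.\<close>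

definition vtx :: "'a list \<Rightarrow> nat \<Rightarrow> 'a" where
  "vtx c k = c ! (k mod length c)"

text \<open>Comparing the unordered pair \<open>{e, f}\<close> leaves open which of the two chords owns the
  smallest index.\<close>

definition interleaved :: "'a list \<Rightarrow> 'a set \<Rightarrow> 'a set \<Rightarrow> bool" where
  "interleaved c e f \<longleftrightarrow>
     (\<exists>i k j l. i < k \<and> k < j \<and> j < l \<and> l < length c \<and>
        {e, f} = {{c ! i, c ! j}, {c ! k, c ! l}})"

definition noninterleaving :: "'a list \<Rightarrow> 'a set set \<Rightarrow> bool" where
  "noninterleaving c F \<longleftrightarrow> (\<forall>e\<in>F. \<forall>f\<in>F. \<not> interleaved c e f)"

text \<open>Any \<open>n\<close> consecutive indices form a system of residues. All injectivity statements about
  positions on the cycle are for such windows \<open>{i..<i + n}\<close>, with a start \<open>i\<close> that can be chosen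
  at an end of the chord under consideration.\<close>

lemma mod_cancel_window:
  fixes a b i n :: nat
  assumes "a mod n = b mod n" "i \<le> a" "a < i + n" "i \<le> b" "b < i + n"
  shows "a = b"
proof -
  have "a = b" if h: "a \<le> b" "a mod n = b mod n" "i \<le> a" "b < i + n" for a b
  proof -
    have "n dvd b - a" using h by (metis mod_eq_dvd_iff_nat)
    moreover have "b - a < n" using h by linarith
    ultimately show "a = b" using h by (metis dvd_imp_le le_antisym not_le zero_less_diff diff_is_0_eq)
  qed
  then show ?thesis using assms by (metis linear)
qed

locale spine_graph =
  fixes V :: "'a set" and E :: "'a set set" and c :: "'a list"
  assumes simple: "simple_graph V E" and ham: "hamiltonian_cycle V E c"
begin

abbreviation n :: nat where "n \<equiv> length c"
abbreviation v :: "nat \<Rightarrow> 'a" where "v \<equiv> vtx c"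
abbreviation step :: "nat \<Rightarrow> 'a set" where "step k \<equiv> {v k, v (Suc k)}"
abbreviation chords :: "'a set set" where "chords \<equiv> E - cycle_edges c"

lemma three_le_length: "3 \<le> n" and spine_distinct: "distinct c" and spine_set: "set c = V" and spine_edges_subset: "cycle_edges c \<subseteq> E"
  using ham by (auto simp: hamiltonian_cycle_def is_cycle_def)

lemma length_pos: "0 < n" using three_le_length by linarith

lemma finite_vertices: "finite V" and edge_subset: "e \<in> E \<Longrightarrow> e \<subseteq> V" and edge_card: "e \<in> E \<Longrightarrow> card e = 2"
  using simple by (auto simp: simple_graph_def)

lemma finite_edges: "finite E"
proof (rule finite_subset)
  show "E \<subseteq> Pow V" using edge_subset by blast
qed (simp add: finite_vertices)

lemma vtx_in: "v k \<in> V"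
  unfolding vtx_def spine_set[symmetric] using length_pos by simp

lemma vtx_eq_iff: "v a = v b \<longleftrightarrow> a mod n = b mod n"
  unfolding vtx_def using spine_distinct length_pos by (simp add: nth_eq_iff_index_eq)

lemma vtx_inj_window: "\<lbrakk>v a = v b; i \<le> a; a < i + n; i \<le> b; b < i + n\<rbrakk> \<Longrightarrow> a = b"
  using mod_cancel_window by (metis vtx_eq_iff)

lemma vtx_add_length [simp]: "v (i + n) = v i" by (simp add: vtx_def)

lemma vtx_nth: "k < n \<Longrightarrow> v k = c ! k" by (simp add: vtx_def)

lemma vertex_obtain_vtx:
  assumes "u \<in> V" obtains k where "i \<le> k" "k < i + n" "u = v k"
proof -
  obtain k0 where k0: "k0 < n" "u = c ! k0" using assms spine_set by (metis in_set_conv_nth)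
  define k where "k = i + (k0 + (n - i mod n)) mod n"
  have "k mod n = (i mod n + (k0 + (n - i mod n))) mod n"
    unfolding k_def by (simp add: mod_add_left_eq mod_add_right_eq)
  also have "i mod n + (k0 + (n - i mod n)) = k0 + n"
    using mod_less_divisor[OF length_pos, of i] by linarith
  finally have "u = v k" using k0 by (simp add: vtx_def)
  moreover have "i \<le> k" "k < i + n" unfolding k_def using length_pos by auto
  ultimately show ?thesis using that by blast
qed

lemma step_mod: "step (k mod n) = step k"
  by (simp add: vtx_def mod_Suc_eq)

lemma cycle_edges_window: "cycle_edges c = step ` {i..<i + n}"
proof -
  have *: "cycle_edges c = range step"
  proof (intro equalityI subsetI)
    fix e assume "e \<in> cycle_edges c"
    then obtain k where "k < n" "e = {c ! k, c ! (Suc k mod n)}" by (auto simp: cycle_edges_def)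
    then have "e = step k" by (simp add: vtx_def)
    then show "e \<in> range step" by blast
  next
    fix e assume "e \<in> range step"
    then obtain k where "e = step (k mod n)" using step_mod by auto
    then have "e = {c ! (k mod n), c ! (Suc (k mod n) mod n)}" by (simp add: vtx_def)
    moreover have "k mod n < n" using length_pos by simp
    ultimately show "e \<in> cycle_edges c" unfolding cycle_edges_def by blast
  qed
  show ?thesis unfolding *
  proof (intro equalityI subsetI)
    fix e assume "e \<in> range step"
    then obtain k where e: "e = step k" by auto
    obtain k' where k': "i \<le> k'" "k' < i + n" "v k = v k'" using vertex_obtain_vtx vtx_in by metis
    then have "k mod n = k' mod n" by (simp add: vtx_eq_iff)
    then have "step k = step k'" using step_mod by metis
    then show "e \<in> step ` {i..<i + n}" using e k' by auto
  qed auto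
qed

text \<open>Two steps with the same pair of ends could only differ by direction, which would make the
  cycle close up after two steps.\<close>

lemma step_inj:
  assumes "step r = step s" "i \<le> r" "r < i + n" "i \<le> s" "s < i + n"
  shows "r = s"
proof (cases "v r = v s")
  case True then show ?thesis using assms vtx_inj_window by blast
next
  case False
  then have "v r = v (Suc s)" "v (Suc r) = v s" using assms(1) by (auto simp: doubleton_eq_iff)
  then have 1: "r mod n = Suc s mod n" "Suc r mod n = s mod n" by (auto simp: vtx_eq_iff)
  then have "Suc (Suc s) mod n = s mod n" by (metis mod_Suc_eq)
  moreover have "s \<le> Suc (Suc s)" "Suc (Suc s) < s + n" "s \<le> s" "s < s + n" using three_le_length by linarith+
  ultimately have "Suc (Suc s) = s" by (rule mod_cancel_window)
  then show ?thesis by simp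
qed

text \<open>The normal form of an edge used for chords: an increasing pair of indices.\<close>

lemma edge_as_vtx_pair:
  assumes "e \<in> E" obtains a b where "a < b" "b < n" "e = {v a, v b}"
proof -
  obtain x y where xy: "e = {x, y}" "x \<noteq> y" using edge_card[OF assms] by (meson card_2_iff)
  have "x \<in> V" "y \<in> V" using edge_subset[OF assms] xy by auto
  obtain a where a: "a < n" "x = v a" using vertex_obtain_vtx[OF \<open>x \<in> V\<close>, of 0] by auto
  obtain b where b: "b < n" "y = v b" using vertex_obtain_vtx[OF \<open>y \<in> V\<close>, of 0] by auto
  have "a \<noteq> b" using a b xy by auto
  then consider "a < b" | "b < a" by linarith
  then show ?thesis
  proof cases
    case 1 then show ?thesis using that[of a b] a b xy by simp
  next
    case 2 then show ?thesis using that[of b a] a b xy by (simp add: insert_commute)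
  qed
qed

lemma interleaved_index:
  assumes "interleaved c e f"
  obtains i k j l where "i < k" "k < j" "j < l" "l < n"
    "(e = {v i, v j} \<and> f = {v k, v l}) \<or> (f = {v i, v j} \<and> e = {v k, v l})"
proof -
  obtain i k j l where o: "i < k" "k < j" "j < l" "l < n" "{e, f} = {{c ! i, c ! j}, {c ! k, c ! l}}"
    using assms unfolding interleaved_def by blast
  then have "{e, f} = {{v i, v j}, {v k, v l}}" by (simp add: vtx_nth)
  then show ?thesis using that[OF o(1-4)] by (auto simp: doubleton_eq_iff)
qed

section \<open>The spine and its chords in an embedding\<close>

lemma cycle_image_window: "cycle_image g c = (\<Union>r\<in>{i..<i + n}. path_image (g (step r)))"
  unfolding cycle_image_def cycle_edges_window[of i] by simp

lemma step_in_spine: "step k \<in> cycle_edges c"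
  using cycle_edges_window[of k] length_pos by auto

lemma step_in_edges: "step k \<in> E" using step_in_spine spine_edges_subset by blast

context
  fixes X :: "'b::t2_space set" and p g
  assumes emb: "graph_embedding V E X p g"
begin

lemma emb_arc: "e \<in> E \<Longrightarrow> arc (g e)"
  and emb_sub: "e \<in> E \<Longrightarrow> path_image (g e) \<subseteq> X"
  and emb_ends: "e \<in> E \<Longrightarrow> {pathstart (g e), pathfinish (g e)} = p ` e"
  and emb_vertex: "\<lbrakk>e \<in> E; u \<in> V; p u \<in> path_image (g e)\<rbrakk> \<Longrightarrow> u \<in> e"
  and emb_edges_Int: "\<lbrakk>e \<in> E; f \<in> E; e \<noteq> f\<rbrakk> \<Longrightarrow> path_image (g e) \<inter> path_image (g f) \<subseteq> p ` (e \<inter> f)"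
  and emb_inj: "inj_on p V"
  using graph_embeddingD[OF emb] by simp_all

lemma emb_vtx_eq_iff: "p (v a) = p (v b) \<longleftrightarrow> v a = v b"
  using emb_inj vtx_in by (metis inj_on_eq_iff)

lemma emb_endpoint: "\<lbrakk>e \<in> E; u \<in> e\<rbrakk> \<Longrightarrow> p u \<in> path_image (g e)"
proof -
  assume "e \<in> E" "u \<in> e"
  then have "p u \<in> {pathstart (g e), pathfinish (g e)}" using emb_ends by blast
  then show ?thesis by auto
qed

text \<open>The arc of an edge carries no preferred direction, so it may have to be reversed before it
  can be joined to its neighbours.\<close>

lemma emb_oriented_arc:
  assumes "e \<in> E" "e = {a, b}"
  obtains \<gamma> where "arc \<gamma>" "pathstart \<gamma> = p a" "pathfinish \<gamma> = p b" "path_image \<gamma> = path_image (g e)"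
proof -
  have ab: "{pathstart (g e), pathfinish (g e)} = {p a, p b}" using emb_ends assms by blast
  then consider "pathstart (g e) = p a" "pathfinish (g e) = p b" | "pathstart (g e) = p b" "pathfinish (g e) = p a"
    by (auto simp: doubleton_eq_iff)
  then show ?thesis
  proof cases
    case 1 then show ?thesis using that[of "g e"] emb_arc[OF assms(1)] by blast
  next
    case 2 then show ?thesis using that[of "reversepath (g e)"] emb_arc[OF assms(1)] by (simp add: arc_reversepath)
  qed
qed

text \<open>The arcs of consecutive edges are joined one after the other; the next edge meets the part
  built so far only in the last vertex, as long as the path has not gone around the whole cycle.\<close>

lemma spine_arc:
  assumes "0 < m" "m < n"
  shows "\<exists>\<gamma>. arc \<gamma> \<and> pathstart \<gamma> = p (v i) \<and> pathfinish \<gamma> = p (v (i + m)) \<and>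
             path_image \<gamma> = (\<Union>r\<in>{i..<i + m}. path_image (g (step r)))"
  using assms
proof (induction m)
  case (Suc m)
  obtain \<epsilon> where \<epsilon>: "arc \<epsilon>" "pathstart \<epsilon> = p (v (i + m))" "pathfinish \<epsilon> = p (v (Suc (i + m)))"
      "path_image \<epsilon> = path_image (g (step (i + m)))"
    using emb_oriented_arc[OF step_in_edges refl] by metis
  show ?case
  proof (cases "m = 0")
    case True then show ?thesis using \<epsilon> by (intro exI[of _ \<epsilon>]) auto
  next
    case False
    then obtain \<gamma> where \<gamma>: "arc \<gamma>" "pathstart \<gamma> = p (v i)" "pathfinish \<gamma> = p (v (i + m))"
        "path_image \<gamma> = (\<Union>r\<in>{i..<i + m}. path_image (g (step r)))"
      using Suc by auto
    have "path_image \<gamma> \<inter> path_image \<epsilon> \<subseteq> {pathstart \<epsilon>}"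
    proof
      fix x assume "x \<in> path_image \<gamma> \<inter> path_image \<epsilon>"
      then obtain r where r: "i \<le> r" "r < i + m" "x \<in> path_image (g (step r)) \<inter> path_image (g (step (i + m)))"
        using \<gamma> \<epsilon> by auto
      have "v (Suc (i + m)) \<noteq> v r" "v (Suc (i + m)) \<noteq> v (Suc r)"
        using vtx_inj_window[of "Suc (i + m)" r i] vtx_inj_window[of "Suc (i + m)" "Suc r" i] r Suc.prems by auto
      then have "step r \<noteq> step (i + m)" "step r \<inter> step (i + m) \<subseteq> {v (i + m)}" by auto
      then have "x \<in> p ` {v (i + m)}"
        using emb_edges_Int[OF step_in_edges step_in_edges, of r "i + m"] r(3) by (meson image_mono subsetD)
      then show "x \<in> {pathstart \<epsilon>}" using \<epsilon> by simp
    qed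
    then have "arc (\<gamma> +++ \<epsilon>)" using \<gamma> \<epsilon> by (intro arc_join) auto
    moreover have "{i..<i + Suc m} = insert (i + m) {i..<i + m}" by auto
    then have "path_image (\<gamma> +++ \<epsilon>) = (\<Union>r\<in>{i..<i + Suc m}. path_image (g (step r)))"
      using \<gamma> \<epsilon> by (simp add: path_image_join Un_commute)
    ultimately show ?thesis using \<gamma> \<epsilon> by (intro exI[of _ "\<gamma> +++ \<epsilon>"]) auto
  qed
qed simp

text \<open>Distinct edges meet only in common vertices, and the index windows \<open>{i..j}\<close> and \<open>{j..i + n}\<close>
  share only the positions of \<open>v i\<close> and \<open>v j\<close>.\<close>

lemma spine_arcs_Int:
  assumes ij: "i < j" "j < i + n"
  shows "(\<Union>r\<in>{i..<j}. path_image (g (step r))) \<inter> (\<Union>r\<in>{j..<i + n}. path_image (g (step r)))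
          = {p (v i), p (v j)}" (is "?A \<inter> ?B = _")
proof (intro equalityI subsetI)
  fix x assume "x \<in> ?A \<inter> ?B"
  then obtain r s where rs: "i \<le> r" "r < j" "j \<le> s" "s < i + n"
      "x \<in> path_image (g (step r)) \<inter> path_image (g (step s))" by auto
  have "step r \<noteq> step s" using step_inj[of r s i] rs ij by linarith
  then have "x \<in> p ` (step r \<inter> step s)" using emb_edges_Int[OF step_in_edges step_in_edges] rs(5) by (meson subsetD)
  then obtain u where u: "x = p u" "u \<in> step r" "u \<in> step s" by auto
  have "\<exists>a. i \<le> a \<and> a \<le> j \<and> u = v a"
    using u(2) rs by (elim insertE) (auto intro: exI[of _ r] exI[of _ "Suc r"])
  then obtain a where a: "i \<le> a" "a \<le> j" "u = v a" by blast
  have "\<exists>b. j \<le> b \<and> b \<le> i + n \<and> u = v b"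
    using u(3) rs by (elim insertE) (auto intro: exI[of _ s] exI[of _ "Suc s"])
  then obtain b where b: "j \<le> b" "b \<le> i + n" "u = v b" by blast
  have "u = v i \<or> u = v j"
  proof (cases "b = i + n")
    case True then show ?thesis using b by simp
  next
    case False
    then have "a = b" using vtx_inj_window[of a b i] a b ij by auto
    then show ?thesis using a b by simp
  qed
  then show "x \<in> {p (v i), p (v j)}" using u by blast
next
  fix x assume x: "x \<in> {p (v i), p (v j)}"
  have 1: "p (v i) \<in> path_image (g (step i))" "p (v j) \<in> path_image (g (step j))"
    by (auto intro: emb_endpoint step_in_edges)
  have "v (Suc (j - 1)) = v j" using ij by simp
  then have 2: "p (v j) \<in> path_image (g (step (j - 1)))" by (intro emb_endpoint step_in_edges) auto
  have "v (Suc (i + n - 1)) = v i" using length_pos by simp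
  then have 3: "p (v i) \<in> path_image (g (step (i + n - 1)))" by (intro emb_endpoint step_in_edges) auto
  have "x = p (v i) \<Longrightarrow> x \<in> ?A" "x = p (v i) \<Longrightarrow> x \<in> ?B" "x = p (v j) \<Longrightarrow> x \<in> ?A" "x = p (v j) \<Longrightarrow> x \<in> ?B"
  proof -
    show "x = p (v i) \<Longrightarrow> x \<in> ?A" using 1 ij by (intro UN_I[of i]) auto
    show "x = p (v i) \<Longrightarrow> x \<in> ?B" using 3 ij by (intro UN_I[of "i + n - 1"]) auto
    show "x = p (v j) \<Longrightarrow> x \<in> ?A" using 2 ij by (intro UN_I[of "j - 1"]) auto
    show "x = p (v j) \<Longrightarrow> x \<in> ?B" using 1 ij by (intro UN_I[of j]) auto
  qed
  then show "x \<in> ?A \<inter> ?B" using x by blast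
qed

text \<open>Both arcs are oriented from \<open>v i\<close> to \<open>v j\<close>, as a theta curve with a chord from \<open>v i\<close> to
  \<open>v j\<close> requires.\<close>

lemma spine_arcs:
  assumes ij: "i < j" "j < i + n"
  obtains \<gamma>1 \<gamma>2 where "arc \<gamma>1" "arc \<gamma>2"
    "pathstart \<gamma>1 = p (v i)" "pathfinish \<gamma>1 = p (v j)" "pathstart \<gamma>2 = p (v i)" "pathfinish \<gamma>2 = p (v j)"
    "path_image \<gamma>1 = (\<Union>r\<in>{i..<j}. path_image (g (step r)))"
    "path_image \<gamma>2 = (\<Union>r\<in>{j..<i + n}. path_image (g (step r)))"
proof -
  obtain \<gamma>1 where 1: "arc \<gamma>1" "pathstart \<gamma>1 = p (v i)" "pathfinish \<gamma>1 = p (v j)"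
      "path_image \<gamma>1 = (\<Union>r\<in>{i..<j}. path_image (g (step r)))"
  proof -
    have "0 < j - i" "j - i < n" "i + (j - i) = j" using ij by linarith+
    then show ?thesis using that spine_arc[of "j - i" i] by metis
  qed
  obtain \<gamma>2 where 2: "arc \<gamma>2" "pathstart \<gamma>2 = p (v j)" "pathfinish \<gamma>2 = p (v i)"
      "path_image \<gamma>2 = (\<Union>r\<in>{j..<i + n}. path_image (g (step r)))"
  proof -
    have "0 < i + n - j" "i + n - j < n" "j + (i + n - j) = i + n" using ij by linarith+
    then show ?thesis using that spine_arc[of "i + n - j" j] by (metis vtx_add_length)
  qed
  show ?thesis
    using that[of \<gamma>1 "reversepath \<gamma>2"] 1 2 by (simp add: arc_reversepath)
qed

lemma spine_simple_closed_path:
  obtains \<gamma> where "simple_path \<gamma>" "pathfinish \<gamma> = pathstart \<gamma>" "path_image \<gamma> = cycle_image g c"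
proof -
  obtain \<gamma>1 \<gamma>2 where *: "arc \<gamma>1" "arc \<gamma>2"
    "pathstart \<gamma>1 = p (v 0)" "pathfinish \<gamma>1 = p (v 1)" "pathstart \<gamma>2 = p (v 0)" "pathfinish \<gamma>2 = p (v 1)"
    "path_image \<gamma>1 = (\<Union>r\<in>{0..<1}. path_image (g (step r)))"
    "path_image \<gamma>2 = (\<Union>r\<in>{1..<0 + n}. path_image (g (step r)))"
    using spine_arcs[of 0 1] three_le_length by auto
  have I: "path_image \<gamma>1 \<inter> path_image \<gamma>2 = {p (v 0), p (v 1)}"
    using spine_arcs_Int[of 0 1] three_le_length * by simp
  have "simple_path (\<gamma>1 +++ reversepath \<gamma>2)"
    by (rule simple_path_join_loop) (use * I in \<open>auto simp: arc_reversepath\<close>)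
  moreover have "{0..<n} = {0..<1} \<union> {1..<n}" using three_le_length by auto
  then have "path_image (\<gamma>1 +++ reversepath \<gamma>2) = cycle_image g c"
    using * by (subst path_image_join) (auto simp: cycle_image_window[of g 0])
  ultimately show ?thesis using that[of "\<gamma>1 +++ reversepath \<gamma>2"] * by simp
qed

lemma vertex_on_spine:
  assumes "u \<in> V"
  shows "p u \<in> cycle_image g c"
proof -
  obtain k where "u = v k" using vertex_obtain_vtx[OF assms, of 0] by blast
  then have "p u \<in> path_image (g (step k))" by (intro emb_endpoint step_in_edges) simp
  then show ?thesis using step_in_spine[of k] by (auto simp: cycle_image_def)
qed

text \<open>As the spine visits every vertex, a chord touches it at both ends, and nowhere else because
  distinct edges meet only in vertices.\<close>

lemma chord_minus_spine:
  assumes e: "e \<in> chords"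
  shows "path_image (g e) - cycle_image g c = g e ` {0<..<1}"
proof -
  have eE: "e \<in> E" using e by blast
  have I: "path_image (g e) \<inter> cycle_image g c = {pathstart (g e), pathfinish (g e)}"
  proof (intro equalityI subsetI)
    fix x assume x: "x \<in> path_image (g e) \<inter> cycle_image g c"
    then obtain f where f: "f \<in> cycle_edges c" "x \<in> path_image (g f)" by (auto simp: cycle_image_def)
    then have "x \<in> p ` (e \<inter> f)" using emb_edges_Int[of e f] e spine_edges_subset x by blast
    then show "x \<in> {pathstart (g e), pathfinish (g e)}" using emb_ends[OF eE] by blast
  next
    fix x assume x: "x \<in> {pathstart (g e), pathfinish (g e)}"
    then have "x \<in> p ` e" using emb_ends[OF eE] by blast
    then show "x \<in> path_image (g e) \<inter> cycle_image g c"
      using edge_subset[OF eE] vertex_on_spine emb_endpoint[OF eE] by blast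
  qed
  have "path_image (g e) - cycle_image g c = path_image (g e) - {pathstart (g e), pathfinish (g e)}"
    using I by blast
  also have "\<dots> = g e ` {0<..<1}"
  proof -
    have inj: "inj_on (g e) {0..1}" using emb_arc[OF eE] by (simp add: arc_def)
    have "path_image (g e) - {pathstart (g e), pathfinish (g e)} = g e ` {0..1} - g e ` {0,1}"
      by (auto simp: path_image_def pathstart_def pathfinish_def)
    also have "\<dots> = g e ` ({0..1} - {0,1})" by (rule inj_on_image_set_diff[OF inj, symmetric]) auto
    also have "{0..1} - {0,1} = {0<..<1::real}" by auto
    finally show ?thesis .
  qed
  finally show ?thesis .
qed

lemma chord_minus_spine_connected:
  assumes e: "e \<in> chords"
  shows "connected (path_image (g e) - cycle_image g c)"
  unfolding chord_minus_spine[OF e]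
proof (rule connected_continuous_image)
  have "continuous_on {0..1} (g e)" using emb_arc[of e] e by (auto simp: arc_def path_def)
  then show "continuous_on {0<..<1} (g e)" by (rule continuous_on_subset) auto
qed simp

lemma closure_chord_minus_spine:
  assumes e: "e \<in> chords"
  shows "closure (path_image (g e) - cycle_image g c) = path_image (g e)"
proof (rule closure_unique)
  have "arc (g e)" using e emb_arc by blast
  then show "closed (path_image (g e))" by (intro compact_imp_closed compact_arc_image)
  have cont: "continuous_on (closure {0<..<1}) (g e)"
    using \<open>arc (g e)\<close> by (auto simp: arc_def path_def)
  fix T assume T: "path_image (g e) - cycle_image g c \<subseteq> T" "closed T"
  then have "g e ` {0<..<1} \<subseteq> T" using chord_minus_spine[OF e] by simp
  then have "g e ` closure {0<..<1} \<subseteq> T" by (rule image_closure_subset[OF cont T(2)])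
  then show "path_image (g e) \<subseteq> T" by (simp add: path_image_def)
qed auto

end

end

section \<open>A chord separates the inside of the spine\<close>

text \<open>The theta-curve argument. The chord splits the inside of the spine into two regions, each
  bounded by the chord and one of the two arcs of the spine between the ends of the chord. The
  connected set lies in one region, and the closure of that region misses the vertices in the
  interior of the other arc. Apart from a second chord, the set will also be a region of the
  complement of an outerplanar graph; this is why it is an arbitrary connected set.\<close>

lemma (in spine_graph) chord_separates_in_plane:
  fixes p :: "'a \<Rightarrow> complex"
  assumes emb: "graph_embedding V E UNIV p g"
    and e: "e \<in> chords" "e = {v i, v j}"
    and ord: "i < k" "k < j" "j < l" "l < i + n"
    and inside_e: "path_image (g e) - cycle_image g c \<subseteq> inside (cycle_image g c)"
    and X: "connected X" "X \<subseteq> inside (cycle_image g c) - path_image (g e)"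
    and cl: "p (v k) \<in> closure X" "p (v l) \<in> closure X"
  shows False
proof -
  let ?A = "\<Union>r\<in>{i..<j}. path_image (g (step r))" and ?B = "\<Union>r\<in>{j..<i + n}. path_image (g (step r))"
  have ij: "i < j" "j < i + n" using ord by linarith+
  have eE: "e \<in> E" using e by blast
  obtain \<gamma>1 \<gamma>2 where \<gamma>: "arc \<gamma>1" "arc \<gamma>2"
    "pathstart \<gamma>1 = p (v i)" "pathfinish \<gamma>1 = p (v j)" "pathstart \<gamma>2 = p (v i)" "pathfinish \<gamma>2 = p (v j)"
    and im: "path_image \<gamma>1 = ?A" "path_image \<gamma>2 = ?B"
    using spine_arcs[OF emb ij] .
  obtain \<epsilon> where \<epsilon>: "arc \<epsilon>" "pathstart \<epsilon> = p (v i)" "pathfinish \<epsilon> = p (v j)" "path_image \<epsilon> = path_image (g e)"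
    using emb_oriented_arc[OF emb eE e(2)] .
  have "{i..<i + n} = {i..<j} \<union> {j..<i + n}" using ij by auto
  then have C: "cycle_image g c = ?A \<union> ?B" unfolding cycle_image_window[of g i] by blast
  have "i mod n \<noteq> j mod n" using mod_cancel_window[of i n j i] ij length_pos by auto
  then have pne: "p (v i) \<noteq> p (v j)" using emb_vtx_eq_iff[OF emb] vtx_eq_iff by simp
  have AB: "?A \<inter> ?B = {p (v i), p (v j)}" by (rule spine_arcs_Int[OF emb ij])
  have "path_image (g e) \<inter> cycle_image g c \<subseteq> p ` e"
  proof
    fix x assume x: "x \<in> path_image (g e) \<inter> cycle_image g c"
    then obtain f where f: "f \<in> cycle_edges c" "x \<in> path_image (g f)" by (auto simp: cycle_image_def)
    then have "x \<in> p ` (e \<inter> f)" using emb_edges_Int[OF emb, of e f] e spine_edges_subset x by blast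
    then show "x \<in> p ` e" by blast
  qed
  then have "?A \<inter> path_image \<epsilon> \<subseteq> {p (v i), p (v j)}" "?B \<inter> path_image \<epsilon> \<subseteq> {p (v i), p (v j)}"
    using C \<epsilon>(4) e(2) by auto
  moreover have "{p (v i), p (v j)} \<subseteq> ?A \<inter> ?B" using AB by simp
  moreover have "{p (v i), p (v j)} \<subseteq> path_image \<epsilon>"
    using \<epsilon> pathstart_in_path_image[of \<epsilon>] pathfinish_in_path_image[of \<epsilon>] by simp
  ultimately have A\<epsilon>: "?A \<inter> path_image \<epsilon> = {p (v i), p (v j)}" and B\<epsilon>: "?B \<inter> path_image \<epsilon> = {p (v i), p (v j)}"
    by blast+
  have "g e (1/2) \<in> path_image (g e) - cycle_image g c"
    unfolding chord_minus_spine[OF emb e(1)] by (rule imageI) simp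
  then have ne: "path_image \<epsilon> \<inter> inside (path_image \<gamma>1 \<union> path_image \<gamma>2) \<noteq> {}"
    using inside_e \<epsilon>(4) unfolding im C by blast
  obtain disj: "inside (?A \<union> path_image \<epsilon>) \<inter> inside (?B \<union> path_image \<epsilon>) = {}"
    and split: "inside (?A \<union> path_image \<epsilon>) \<union> inside (?B \<union> path_image \<epsilon>) \<union>
             (path_image \<epsilon> - {p (v i), p (v j)}) = inside (?A \<union> ?B)"
    by (rule split_inside_simple_closed_curve[of \<gamma>1 "p (v i)" "p (v j)" \<gamma>2 \<epsilon>, unfolded im])
       (use \<gamma> \<epsilon> pne AB A\<epsilon> B\<epsilon> ne im in \<open>auto intro: arc_imp_simple_path\<close>)
  have closed: "closed (?A \<union> path_image \<epsilon>)" "closed (?B \<union> path_image \<epsilon>)"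
    using \<gamma> \<epsilon>(1) im by (metis closed_Un compact_imp_closed compact_arc_image)+
  have "X \<subseteq> inside (?A \<union> path_image \<epsilon>) \<union> inside (?B \<union> path_image \<epsilon>)"
    using X(2) split \<epsilon>(4) unfolding C by blast
  then have X_side: "inside (?A \<union> path_image \<epsilon>) \<inter> X = {} \<or> inside (?B \<union> path_image \<epsilon>) \<inter> X = {}"
    using connectedD[OF X(1) open_inside[OF closed(1)] open_inside[OF closed(2)]] disj by blast
  have off: "p (v a) \<notin> path_image \<epsilon>" if "v a \<notin> {v i, v j}" for a
    using emb_vertex[OF emb eE, of "v a"] vtx_in that e(2) \<epsilon>(4) by auto
  have inA: "p (v k) \<in> ?A" using ord emb_endpoint[OF emb step_in_edges, of "v k" k] by (intro UN_I[of k]) auto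
  have inB: "p (v l) \<in> ?B" using ord emb_endpoint[OF emb step_in_edges, of "v l" l] by (intro UN_I[of l]) auto
  have kne: "v k \<notin> {v i, v j}" using vtx_inj_window[of k i i] vtx_inj_window[of k j i] ord length_pos by auto
  have lne: "v l \<notin> {v i, v j}" using vtx_inj_window[of l i i] vtx_inj_window[of l j i] ord length_pos by auto
  have notB: "p (v k) \<notin> ?B" using inA AB kne emb_vtx_eq_iff[OF emb] by blast
  have notA: "p (v l) \<notin> ?A" using inB AB lne emb_vtx_eq_iff[OF emb] by blast
  have no_in: "p (v a) \<notin> inside (?A \<union> ?B)" for a
    using vertex_on_spine[OF emb vtx_in, of a] inside_no_overlap[of "?A \<union> ?B"] unfolding C by blast
  have cl_A: "closure (inside (?A \<union> path_image \<epsilon>)) \<subseteq> ?A \<union> path_image \<epsilon> \<union> inside (?A \<union> ?B)"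
    using closure_inside_subset[OF closed(1)] split by blast
  have cl_B: "closure (inside (?B \<union> path_image \<epsilon>)) \<subseteq> ?B \<union> path_image \<epsilon> \<union> inside (?A \<union> ?B)"
    using closure_inside_subset[OF closed(2)] split by blast
  show False
  proof (cases "X \<subseteq> inside (?A \<union> path_image \<epsilon>)")
    case True
    then have "p (v l) \<in> ?A \<union> path_image \<epsilon> \<union> inside (?A \<union> ?B)"
      using cl(2) cl_A closure_mono by blast
    then show False using notA off[OF lne] no_in[of l] by blast
  next
    case False
    then have "X \<subseteq> inside (?B \<union> path_image \<epsilon>)"
      using X_side \<open>X \<subseteq> _ \<union> _\<close> by blast
    then have "p (v k) \<in> ?B \<union> path_image \<epsilon> \<union> inside (?A \<union> ?B)"
      using cl(1) cl_B closure_mono by blast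
    then show False using notB off[OF kne] no_in[of k] by blast
  qed
qed

section \<open>The two sides of a closed curve on the sphere\<close>

lemma punctured_sphere2_plane:
  assumes "q \<in> sphere2"
  obtains h k where "homeomorphism (sphere2 - {q}) (UNIV :: complex set) h k"
proof -
  have "(sphere2 - {q}) homeomorphic (UNIV :: complex set)"
    by (rule homeomorphic_punctured_sphere_affine) (use assms in auto)
  then show ?thesis using that by (auto simp: homeomorphic_def)
qed

text \<open>A side of a curve on the sphere is described by what is needed to apply plane separation to
  it: a chart that omits one point \<open>q\<close> outside the side and off the curve, and that sends the side
  to the inside of the image curve.\<close>

definition disc_side :: "space3 set \<Rightarrow> space3 set \<Rightarrow> bool" where
  "disc_side C D \<longleftrightarrow>
     (\<exists>q h. q \<in> sphere2 \<and> q \<notin> C \<and> q \<notin> D \<and> D \<subseteq> sphere2 \<and>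
        continuous_on (sphere2 - {q}) h \<and> inj_on h (sphere2 - {q}) \<and>
        h ` D \<subseteq> inside (h ` C :: complex set))"

text \<open>The point at infinity of the first chart is \<open>q0\<close>; there the Jordan curve theorem gives an
  inside, which becomes \<open>A\<close>, and everything else off the curve becomes \<open>B\<close>. So the first chart
  already shows \<open>A\<close> as a side. A second chart, punctured at a point of \<open>A\<close>, is needed to turn
  \<open>B\<close>, which contains \<open>q0\<close>, into a bounded set.\<close>

lemma sides_on_sphere:
  fixes \<gamma> :: "real \<Rightarrow> space3"
  assumes \<gamma>: "simple_path \<gamma>" "pathfinish \<gamma> = pathstart \<gamma>" "path_image \<gamma> = C"
    and C: "C \<subseteq> sphere2" and q0: "q0 \<in> sphere2" "q0 \<notin> C"
  obtains A B where "openin (top_of_set sphere2) A" "openin (top_of_set sphere2) B"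
    "A \<inter> B = {}" "A \<union> B = sphere2 - C" "disc_side C A" "disc_side C B"
proof -
  \<comment> \<open>The Jordan curve theorem in an arbitrary chart; it is used for two different punctures.\<close>
  have jordan: "inside (h ` C) \<noteq> {}" "open (inside (h ` C))" "bounded (inside (h ` C))" "open (outside (h ` C))"
      "connected (outside (h ` C))" "\<not> bounded (outside (h ` C))" "compact (h ` C)"
    if q: "q \<notin> C" and h: "homeomorphism (sphere2 - {q}) (UNIV :: complex set) h k" for q h k
  proof -
    have "C \<subseteq> sphere2 - {q}" using q C by blast
    then have "continuous_on C h" "inj_on h C"
      using h by (meson homeomorphism_def continuous_on_subset, metis homeomorphism_def inj_on_inverseI inj_on_subset)
    then have "simple_path (h \<circ> \<gamma>)" "pathfinish (h \<circ> \<gamma>) = pathstart (h \<circ> \<gamma>)"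
      using \<gamma> by (auto intro!: simple_path_continuous_image simp: pathfinish_compose pathstart_compose)
    moreover have "path_image (h \<circ> \<gamma>) = h ` C" using \<gamma> by (simp add: path_image_compose)
    ultimately show "inside (h ` C) \<noteq> {}" "open (inside (h ` C))" "bounded (inside (h ` C))" "open (outside (h ` C))"
      "connected (outside (h ` C))" "\<not> bounded (outside (h ` C))" "compact (h ` C)"
      using Jordan_inside_outside[of "h \<circ> \<gamma>"] compact_simple_path_image by force+
  qed
  obtain h k where hk: "homeomorphism (sphere2 - {q0}) (UNIV :: complex set) h k"
    using punctured_sphere2_plane[OF q0(1)] .
  note J = jordan[OF q0(2) hk]
  have kh: "\<And>x. x \<in> sphere2 - {q0} \<Longrightarrow> k (h x) = x" and hk': "\<And>z. h (k z) = z"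
    and cont_h: "continuous_on (sphere2 - {q0}) h" and cont_k: "continuous_on UNIV k"
    using hk unfolding homeomorphism_def by simp_all
  have k_in: "\<And>z. k z \<in> sphere2 - {q0}" using hk unfolding homeomorphism_def by blast
  have inj_h: "inj_on h (sphere2 - {q0})" using kh by (metis inj_on_inverseI)
  define A where "A = (sphere2 - {q0}) \<inter> h -` inside (h ` C)"
  define B where "B = sphere2 - C - A"
  have hC: "h x \<notin> inside (h ` C)" if "x \<in> C" for x using that inside_no_overlap[of "h ` C"] by blast
  have AC: "A \<inter> C = {}" using hC by (auto simp: A_def)
  have open_punct: "openin (top_of_set sphere2) (sphere2 - {q})" for q :: space3
    by (rule openin_delete) simp
  have "openin (top_of_set (sphere2 - {q0})) A"
    unfolding A_def using continuous_openin_preimage_gen[OF cont_h J(2)] .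
  then have oA: "openin (top_of_set sphere2) A" using open_punct by (rule openin_trans)
  \<comment> \<open>\<open>B\<close> is open because the curve together with its inside is compact, also on the sphere.\<close>
  have "A \<union> C = k ` (h ` C \<union> inside (h ` C))"
  proof (intro equalityI subsetI)
    fix x assume x: "x \<in> A \<union> C"
    then have "x \<in> sphere2 - {q0}" using C q0 by (auto simp: A_def)
    moreover have "h x \<in> h ` C \<union> inside (h ` C)" using x by (auto simp: A_def)
    ultimately show "x \<in> k ` (h ` C \<union> inside (h ` C))" using kh by (metis imageI)
  next
    fix x assume "x \<in> k ` (h ` C \<union> inside (h ` C))"
    then obtain z where z: "x = k z" "z \<in> h ` C \<union> inside (h ` C)" by blast
    show "x \<in> A \<union> C"
    proof (cases "z \<in> inside (h ` C)")
      case True then show ?thesis using z k_in[of z] hk'[of z] by (simp add: A_def)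
    next
      case False
      then obtain y where "y \<in> C" "z = h y" using z by blast
      moreover have "y \<in> sphere2 - {q0}" using \<open>y \<in> C\<close> C q0 by blast
      ultimately have "x = y" using z(1) kh[of y] by simp
      then show ?thesis using \<open>y \<in> C\<close> by simp
    qed
  qed
  moreover have "closed (h ` C \<union> inside (h ` C))"
    using J(4) by (metis closed_def union_with_inside double_complement)
  then have "compact (h ` C \<union> inside (h ` C))"
    using J(3,7) by (simp add: compact_eq_bounded_closed)
  ultimately have "compact (A \<union> C)"
    using cont_k by (metis compact_continuous_image continuous_on_subset top_greatest)
  then have "closedin (top_of_set sphere2) (A \<union> C)"
    using C by (intro closed_subset compact_imp_closed) (auto simp: A_def)
  moreover have "B = sphere2 - (A \<union> C)" by (auto simp: B_def)
  ultimately have oB: "openin (top_of_set sphere2) B" by (simp add: openin_diff)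
  have AB: "A \<inter> B = {}" "A \<union> B = sphere2 - C" using AC by (auto simp: B_def A_def)
  have "disc_side C A" unfolding disc_side_def
    by (rule exI[of _ q0], rule exI[of _ h]) (use q0 cont_h inj_h in \<open>auto simp: A_def\<close>)
  moreover have "disc_side C B"
  proof -
    \<comment> \<open>In the chart punctured at a point of \<open>A\<close>, the image of \<open>B\<close> is bounded. The outside of the
      image curve is connected and unbounded, hence covered by the image of \<open>A\<close> alone, which leaves
      only the inside for \<open>B\<close>.\<close>
    obtain z where "z \<in> inside (h ` C)" using J(1) by blast
    then have q1: "k z \<in> A" using k_in hk' by (auto simp: A_def)
    define q1 where "q1 = k z"
    have q1: "q1 \<in> A" "q1 \<in> sphere2" "q1 \<notin> C" "q1 \<notin> B"
      using q1 AC by (auto simp: A_def B_def q1_def)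
    obtain h1 k1 where hk1: "homeomorphism (sphere2 - {q1}) (UNIV :: complex set) h1 k1"
      using punctured_sphere2_plane[OF q1(2)] .
    note J1 = jordan[OF q1(3) hk1]
    have kh1: "\<And>x. x \<in> sphere2 - {q1} \<Longrightarrow> k1 (h1 x) = x" and hk1': "\<And>z. h1 (k1 z) = z"
      and cont_h1: "continuous_on (sphere2 - {q1}) h1"
      using hk1 unfolding homeomorphism_def by simp_all
    have k1_in: "\<And>z. k1 z \<in> sphere2 - {q1}" using hk1 unfolding homeomorphism_def by blast
    have inj_h1: "inj_on h1 (sphere2 - {q1})" using kh1 by (metis inj_on_inverseI)
    have open1: "open (h1 ` U)" if "openin (top_of_set sphere2) U" "U \<subseteq> sphere2 - {q1}" for U
    proof -
      have "openin (top_of_set (sphere2 - {q1})) U"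
        using that by (meson Diff_subset openin_subset_trans)
      then show ?thesis using homeomorphism_imp_open_map[OF hk1] by simp
    qed
    have oB1: "open (h1 ` B)" using open1 oB q1 by (auto simp: B_def)
    have "openin (top_of_set sphere2) (A - {q1})" using oA by (rule openin_delete)
    then have oA1: "open (h1 ` (A - {q1}))" by (rule open1) (auto simp: A_def)
    have "compact (sphere2 - A)"
      using oA by (metis closedin_compact compact_sphere closedin_diff closedin_topspace topspace_euclidean_subtopology)
    then have "compact (h1 ` (sphere2 - A))"
      using q1 by (intro compact_continuous_image continuous_on_subset[OF cont_h1]) auto
    then have bdB: "bounded (h1 ` B)"
      by (rule bounded_subset[OF compact_imp_bounded]) (auto simp: B_def)
    have disj: "h1 ` (A - {q1}) \<inter> h1 ` B = {}"
    proof -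
      have "h1 ` (A - {q1}) \<inter> h1 ` B = h1 ` ((A - {q1}) \<inter> B)"
        by (rule inj_on_image_Int[OF inj_h1, symmetric]) (use q1 in \<open>auto simp: A_def B_def\<close>)
      then show ?thesis using AB by auto
    qed
    have "h1 ` B \<inter> h1 ` C = h1 ` (B \<inter> C)"
      by (rule inj_on_image_Int[OF inj_h1, symmetric]) (use q1 C in \<open>auto simp: B_def\<close>)
    then have BC: "h1 ` B \<inter> h1 ` C = {}" by (auto simp: B_def)
    have cover: "outside (h1 ` C) \<subseteq> h1 ` (A - {q1}) \<union> h1 ` B"
    proof
      fix z assume z: "z \<in> outside (h1 ` C)"
      then have "z \<notin> h1 ` C" using outside_no_overlap[of "h1 ` C"] by blast
      then have "k1 z \<notin> C" using hk1' by (metis imageI)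
      then have "k1 z \<in> (A - {q1}) \<union> B" using k1_in[of z] AB by blast
      then have "h1 (k1 z) \<in> h1 ` (A - {q1}) \<union> h1 ` B" by blast
      then show "z \<in> h1 ` (A - {q1}) \<union> h1 ` B" using hk1' by simp
    qed
    have "h1 ` (A - {q1}) \<inter> outside (h1 ` C) = {} \<or> h1 ` B \<inter> outside (h1 ` C) = {}"
      using connectedD[OF J1(5) oA1 oB1] disj cover by blast
    moreover have "h1 ` (A - {q1}) \<inter> outside (h1 ` C) \<noteq> {}"
    proof
      assume "h1 ` (A - {q1}) \<inter> outside (h1 ` C) = {}"
      then have "outside (h1 ` C) \<subseteq> h1 ` B" using cover by blast
      then show False using J1(6) bounded_subset[OF bdB] by blast
    qed
    ultimately have "h1 ` B \<inter> outside (h1 ` C) = {}" by blast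
    then have "h1 ` B \<subseteq> inside (h1 ` C)" using BC inside_Un_outside[of "h1 ` C"] by blast
    then show ?thesis unfolding disc_side_def
      by (intro exI[of _ q1] exI[of _ h1]) (use q1 cont_h1 inj_h1 in \<open>auto simp: B_def\<close>)
  qed
  ultimately show ?thesis using that oA oB AB by blast
qed

lemma connected_one_side:
  assumes "openin (top_of_set S) A" "openin (top_of_set S) B" "A \<inter> B = {}" "connected X" "X \<subseteq> A \<union> B"
  shows "X \<subseteq> A \<or> X \<subseteq> B"
proof -
  obtain U W where UW: "open U" "open W" "A = S \<inter> U" "B = S \<inter> W"
    using assms(1,2) by (auto simp: openin_open)
  then have "U \<inter> X = {} \<or> W \<inter> X = {}"
    using connectedD[OF assms(4) UW(1,2)] assms(3,5) by blast
  then show ?thesis using UW assms(5) by blast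
qed

lemma image_in_closure_image:
  fixes h :: "'b::metric_space \<Rightarrow> 'c::metric_space"
  assumes "continuous_on S h" "X \<subseteq> S" "x \<in> S" "x \<in> closure X"
  shows "h x \<in> closure (h ` X)"
proof -
  obtain u where u: "\<forall>m. u m \<in> X" "u \<longlonglongrightarrow> x" using assms(4) by (auto simp: closure_sequential)
  then have "(h \<circ> u) \<longlonglongrightarrow> h x"
    using assms(1-3) by (metis continuous_on_sequentially subsetD)
  then show ?thesis unfolding closure_sequential using u(1) by (intro exI[of _ "h \<circ> u"]) auto
qed

context spine_graph
begin

text \<open>Transport of \<open>chord_separates_in_plane\<close> along the chart of the side. Other edges may pass
  through the puncture of the chart, so the graph is first reduced to the spine and the chord.\<close>

lemma chord_separates_on_sphere:
  assumes emb: "graph_embedding V E sphere2 p g"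
    and e: "e \<in> chords" "e = {v i, v j}"
    and ord: "i < k" "k < j" "j < l" "l < i + n"
    and D: "disc_side (cycle_image g c) D"
    and sides: "path_image (g e) - cycle_image g c \<subseteq> D"
    and X: "connected X" "X \<subseteq> D - path_image (g e)"
    and cl: "p (v k) \<in> closure X" "p (v l) \<in> closure X"
  shows False
proof -
  let ?E = "insert e (cycle_edges c)"
  interpret s: spine_graph V ?E c
    using simple ham e spine_edges_subset by unfold_locales (auto simp: simple_graph_def hamiltonian_cycle_def is_cycle_def)
  obtain q h where q: "q \<in> sphere2" "q \<notin> cycle_image g c" "q \<notin> D" and DS: "D \<subseteq> sphere2"
    and h: "continuous_on (sphere2 - {q}) h" "inj_on h (sphere2 - {q})"
    and ins: "h ` D \<subseteq> inside (h ` cycle_image g c :: complex set)"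
    using D unfolding disc_side_def by blast
  have qg: "path_image (g f) \<subseteq> sphere2 - {q}" if "f \<in> ?E" for f
  proof -
    have "path_image (g f) \<subseteq> sphere2" using emb_sub[OF emb] that e spine_edges_subset by blast
    moreover have "q \<notin> path_image (g f)" using that q sides by (auto simp: cycle_image_def)
    ultimately show ?thesis by blast
  qed
  have pC: "p u \<in> cycle_image g c" if "u \<in> V" for u by (rule vertex_on_spine[OF emb that])
  have CS: "cycle_image g c \<subseteq> sphere2 - {q}" using qg by (auto simp: cycle_image_def)
  have emb1: "graph_embedding V ?E (sphere2 - {q}) p g"
  proof (rule graph_embedding_mono[OF emb])
    show "?E \<subseteq> E" using e spine_edges_subset by blast
    show "p ` V \<subseteq> sphere2 - {q}" using pC CS by blast
  qed (rule qg)
  have "graph_embedding V ?E (h ` (sphere2 - {q})) (h \<circ> p) (\<lambda>e. h \<circ> g e)"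
    by (rule graph_embedding_image[OF emb1 h])
  then have emb2: "graph_embedding V ?E UNIV (h \<circ> p) (\<lambda>e. h \<circ> g e)"
    by (rule graph_embedding_mono) auto
  have C2: "cycle_image (\<lambda>e. h \<circ> g e) c = h ` cycle_image g c"
    by (auto simp: cycle_image_def path_image_compose)
  have ei: "path_image (g e) \<subseteq> sphere2 - {q}" using qg by blast
  have inj_diff: "h ` Y - h ` Z = h ` (Y - Z)" if "Y \<subseteq> sphere2 - {q}" "Z \<subseteq> sphere2 - {q}" for Y Z
    by (rule inj_on_image_set_diff[OF h(2), symmetric]) (use that in auto)
  have XS: "X \<subseteq> sphere2 - {q}" using X DS q by blast
  show False
  proof (rule s.chord_separates_in_plane[OF emb2 _ e(2) ord, of "h ` X"])
    show "e \<in> ?E - cycle_edges c" using e by blast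
    show "path_image (h \<circ> g e) - cycle_image (\<lambda>e. h \<circ> g e) c \<subseteq> inside (cycle_image (\<lambda>e. h \<circ> g e) c)"
      unfolding C2 path_image_compose inj_diff[OF ei CS] using ins sides by blast
    show "connected (h ` X)"
      using X(1) XS h by (meson connected_continuous_image continuous_on_subset)
    have "X - path_image (g e) = X" using X(2) by blast
    then have "h ` X - h ` path_image (g e) = h ` X" using inj_diff[OF XS ei] by simp
    then have "h ` X \<inter> h ` path_image (g e) = {}" by blast
    then show "h ` X \<subseteq> inside (cycle_image (\<lambda>e. h \<circ> g e) c) - path_image (h \<circ> g e)"
      unfolding C2 path_image_compose using ins X(2) by blast
    have "p (v a) \<in> sphere2 - {q}" for a using pC[OF vtx_in] CS by blast
    then show "(h \<circ> p) (v k) \<in> closure (h ` X)" "(h \<circ> p) (v l) \<in> closure (h ` X)"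
      using image_in_closure_image[OF h(1) XS] cl by auto
  qed
qed

lemma chord_ends_in_closure:
  fixes X :: "'b::t2_space set"
  assumes emb: "graph_embedding V E X p g" and e: "e \<in> chords" "u \<in> e"
  shows "p u \<in> closure (path_image (g e) - cycle_image g c)"
  unfolding closure_chord_minus_spine[OF emb e(1)] using emb_endpoint[OF emb] e by blast

lemma chord_Int_chord:
  fixes X :: "'b::t2_space set"
  assumes emb: "graph_embedding V E X p g" and e: "e \<in> chords" and f: "f \<in> chords" and "e \<noteq> f"
  shows "(path_image (g e) - cycle_image g c) \<inter> path_image (g f) = {}"
proof -
  have "path_image (g e) \<inter> path_image (g f) \<subseteq> p ` (e \<inter> f)" using emb_edges_Int[OF emb] assms by blast
  also have "\<dots> \<subseteq> cycle_image g c" using vertex_on_spine[OF emb] edge_subset e by blast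
  finally show ?thesis by blast
qed

lemma interleaved_distinct:
  assumes "interleaved c e f" shows "e \<noteq> f"
proof
  assume "e = f"
  obtain i k j l where *: "i < k" "k < j" "j < l" "l < n"
    "(e = {v i, v j} \<and> f = {v k, v l}) \<or> (f = {v i, v j} \<and> e = {v k, v l})"
    using interleaved_index[OF assms] .
  then have "{v i, v j} = {v k, v l}" using \<open>e = f\<close> by blast
  then have "v i = v k \<or> v i = v l" by blast
  then show False using vtx_inj_window[of i k i] vtx_inj_window[of i l i] * length_pos by auto
qed

text \<open>The open arc of one chord is a connected set that avoids the other chord and accumulates at
  its own ends. If the chords interleave, these ends lie on different arcs of the spine, which a
  separation property of the side \<open>D\<close> forbids. The property is a hypothesis in order to serve both
  the sphere and the plane.\<close>

lemma separated_not_interleaved: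
  fixes X D :: "'b::t2_space set"
  assumes emb: "graph_embedding V E X p g"
    and e: "e \<in> chords" and f: "f \<in> chords"
    and sides: "path_image (g e) - cycle_image g c \<subseteq> D" "path_image (g f) - cycle_image g c \<subseteq> D"
    and separates: "\<And>e i j k l Y. \<lbrakk>e \<in> chords; e = {v i, v j}; i < k; k < j; j < l; l < i + n;
        path_image (g e) - cycle_image g c \<subseteq> D; connected Y; Y \<subseteq> D - path_image (g e);
        p (v k) \<in> closure Y; p (v l) \<in> closure Y\<rbrakk> \<Longrightarrow> False"
  shows "\<not> interleaved c e f"
proof
  assume I: "interleaved c e f"
  have False if ef: "e \<in> chords" "f \<in> chords" "e \<noteq> f" "e = {v i, v j}" "f = {v k, v l}"
    "i < k" "k < j" "j < l" "l < n"
    "path_image (g e) - cycle_image g c \<subseteq> D" "path_image (g f) - cycle_image g c \<subseteq> D" for e f i j k l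
  proof (rule separates[OF ef(1,4,6-8) _ ef(10)])
    show "l < i + n" using ef by simp
    show "connected (path_image (g f) - cycle_image g c)" by (rule chord_minus_spine_connected[OF emb ef(2)])
    show "path_image (g f) - cycle_image g c \<subseteq> D - path_image (g e)"
      using chord_Int_chord[OF emb ef(2,1)] ef by blast
    show "p (v k) \<in> closure (path_image (g f) - cycle_image g c)"
      "p (v l) \<in> closure (path_image (g f) - cycle_image g c)"
      using chord_ends_in_closure[OF emb ef(2)] ef(5) by auto
  qed
  then show False using interleaved_index[OF I] interleaved_distinct[OF I] e f sides by metis
qed

lemma chords_on_same_side:
  assumes emb: "graph_embedding V E sphere2 p g"
    and e: "e \<in> chords" and f: "f \<in> chords"
    and D: "disc_side (cycle_image g c) D"
    and sides: "path_image (g e) - cycle_image g c \<subseteq> D" "path_image (g f) - cycle_image g c \<subseteq> D"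
  shows "\<not> interleaved c e f"
  by (rule separated_not_interleaved[OF emb e f sides chord_separates_on_sphere[OF emb _ _ _ _ _ _ D]])

lemma chords_inside_not_interleaved:
  fixes p :: "'a \<Rightarrow> complex"
  assumes emb: "graph_embedding V E UNIV p g"
    and e: "e \<in> chords" and f: "f \<in> chords"
    and ins: "path_image (g e) - cycle_image g c \<subseteq> inside (cycle_image g c)"
      "path_image (g f) - cycle_image g c \<subseteq> inside (cycle_image g c)"
  shows "\<not> interleaved c e f"
  by (rule separated_not_interleaved[OF emb e f ins chord_separates_in_plane[OF emb]])

lemma spine_sides:
  assumes emb: "graph_embedding V E sphere2 p g" and q0: "q0 \<in> sphere2" "q0 \<notin> cycle_image g c"
  obtains A B where "openin (top_of_set sphere2) A" "openin (top_of_set sphere2) B"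
    "A \<inter> B = {}" "A \<union> B = sphere2 - cycle_image g c"
    "disc_side (cycle_image g c) A" "disc_side (cycle_image g c) B"
proof -
  obtain \<gamma> where "simple_path \<gamma>" "pathfinish \<gamma> = pathstart \<gamma>" "path_image \<gamma> = cycle_image g c"
    using spine_simple_closed_path[OF emb] .
  moreover have "cycle_image g c \<subseteq> sphere2"
    using emb_sub[OF emb] spine_edges_subset unfolding cycle_image_def by blast
  ultimately show ?thesis using sides_on_sphere[OF _ _ _ _ q0] that by metis
qed

section \<open>From embeddings to pages\<close>

text \<open>A page consists of the chords on one side of the spine. Any chord provides a point off the
  spine, which the description of the sides requires; without chords there is nothing to show.\<close>

lemma sphere_embedding_two_page:
  assumes emb: "graph_embedding V E sphere2 p g"
  shows "\<exists>F. noninterleaving c F \<and> noninterleaving c (chords - F)"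
proof (cases "chords = {}")
  case True
  then show ?thesis by (intro exI[of _ "{}"]) (simp only: noninterleaving_def, simp)
next
  case False
  then obtain e0 where e0: "e0 \<in> chords" by blast
  have "g e0 (1/2) \<in> path_image (g e0) - cycle_image g c"
    unfolding chord_minus_spine[OF emb e0] by (rule imageI) simp
  moreover have "path_image (g e0) \<subseteq> sphere2" using emb_sub[OF emb] e0 by blast
  ultimately have "g e0 (1/2) \<in> sphere2" "g e0 (1/2) \<notin> cycle_image g c" by blast+
  from spine_sides[OF emb this] obtain A B where AB: "openin (top_of_set sphere2) A"
      "openin (top_of_set sphere2) B" "A \<inter> B = {}" "A \<union> B = sphere2 - cycle_image g c"
    and disc: "disc_side (cycle_image g c) A" "disc_side (cycle_image g c) B" .
  define F where "F = {e \<in> chords. path_image (g e) - cycle_image g c \<subseteq> A}"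
  have B: "path_image (g e) - cycle_image g c \<subseteq> B" if "e \<in> chords - F" for e
  proof -
    have "path_image (g e) \<subseteq> sphere2" using emb_sub[OF emb] that by blast
    then have "path_image (g e) - cycle_image g c \<subseteq> A \<union> B" using AB by blast
    then show ?thesis
      using connected_one_side[OF AB(1-3) chord_minus_spine_connected[OF emb]] that by (auto simp: F_def)
  qed
  have "noninterleaving c F" unfolding noninterleaving_def
    by (intro ballI chords_on_same_side[OF emb _ _ disc(1)]) (simp_all add: F_def)
  moreover have "noninterleaving c (chords - F)" unfolding noninterleaving_def
    by (intro ballI chords_on_same_side[OF emb _ _ disc(2)] B) simp_all
  ultimately show ?thesis by blast
qed

lemma planar_two_page:
  assumes "planar V E"
  shows "\<exists>F. noninterleaving c F \<and> noninterleaving c (chords - F)"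
proof -
  have "\<exists>p g. graph_embedding V E sphere2 p g"
    if emb: "graph_embedding V E (UNIV :: complex set) p g" for p g
  proof -
    define q :: space3 where "q = (1, 0)"
    have "q \<in> sphere2" by (simp add: q_def norm_Pair)
    then obtain h k where hk: "homeomorphism (sphere2 - {q}) (UNIV :: complex set) h k"
      using punctured_sphere2_plane by blast
    then have k: "continuous_on UNIV k" "k ` UNIV = sphere2 - {q}" and hk': "\<And>z. h (k z) = z"
      unfolding homeomorphism_def by simp_all
    have inj: "inj_on k UNIV" using hk' by (metis injI)
    have "graph_embedding V E (k ` UNIV) (k \<circ> p) (\<lambda>e. k \<circ> g e)"
      by (rule graph_embedding_image[OF emb k(1) inj])
    then have "graph_embedding V E sphere2 (k \<circ> p) (\<lambda>e. k \<circ> g e)"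
      by (rule graph_embedding_mono) (use k(2) in \<open>auto simp: path_image_def\<close>)
    then show ?thesis by blast
  qed
  then show ?thesis using assms sphere_embedding_two_page unfolding planar_def by blast
qed

text \<open>The region \<open>R\<close> that has every vertex on its boundary is connected and avoids all chords. A
  chord that interleaves with another one has vertices on both of its sides, so it cannot lie on
  the side of \<open>R\<close>. Two interleaving chords would therefore both lie on the opposite side, where
  they separate each other.\<close>

lemma outerplanar_one_page:
  assumes "outerplanar V E"
  shows "noninterleaving c chords"
proof -
  obtain p g R where emb: "graph_embedding V E sphere2 p g"
    and R: "R \<in> components (sphere2 - graph_image V E p g)"
    and front: "p ` V \<subseteq> top_of_set sphere2 frontier_of R"
    using assms unfolding outerplanar_def by blast
  have conR: "connected R" "R \<noteq> {}" "R \<subseteq> sphere2 - graph_image V E p g"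
    using R in_components_connected in_components_nonempty in_components_subset by blast+
  have Rg: "R \<inter> path_image (g e) = {}" if "e \<in> E" for e
    using conR(3) that by (auto simp: graph_image_def)
  then have RC: "R \<inter> cycle_image g c = {}" using spine_edges_subset by (auto simp: cycle_image_def)
  have clR: "p u \<in> closure R" if "u \<in> V" for u
  proof -
    have "p u \<in> top_of_set sphere2 closure_of R"
      using front that by (auto simp: frontier_of_def)
    then have "p u \<in> euclidean closure_of R"
      using closure_of_subtopology_subset[of euclidean sphere2 R] by blast
    then show ?thesis by simp
  qed
  obtain q0 where "q0 \<in> R" using conR by blast
  then have "q0 \<in> sphere2" "q0 \<notin> cycle_image g c" using conR RC by blast+
  from spine_sides[OF emb this] obtain A B where AB: "openin (top_of_set sphere2) A"
      "openin (top_of_set sphere2) B" "A \<inter> B = {}" "A \<union> B = sphere2 - cycle_image g c"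
    and disc: "disc_side (cycle_image g c) A" "disc_side (cycle_image g c) B" .
  have side: "Y \<subseteq> A \<or> Y \<subseteq> B" if "connected Y" "Y \<subseteq> sphere2 - cycle_image g c" for Y
    using connected_one_side[OF AB(1-3) that(1)] that(2) AB(4) by blast
  have eside: "path_image (g e) - cycle_image g c \<subseteq> A \<or> path_image (g e) - cycle_image g c \<subseteq> B"
    if "e \<in> chords" for e
    by (rule side[OF chord_minus_spine_connected[OF emb that]]) (use emb_sub[OF emb, of e] that in blast)
  have Rside: "R \<subseteq> A \<or> R \<subseteq> B"
    by (rule side[OF conR(1)]) (use conR RC in blast)
  have apart: "\<not> path_image (g e) - cycle_image g c \<subseteq> D"
    if "disc_side (cycle_image g c) D" "R \<subseteq> D" "e \<in> chords" "e = {v i, v j}"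
      "i < k" "k < j" "j < l" "l < i + n" for D e i j k l
  proof
    assume *: "path_image (g e) - cycle_image g c \<subseteq> D"
    show False
      by (rule chord_separates_on_sphere[OF emb that(3-8) that(1) * conR(1)])
         (use that Rg vtx_in clR in auto)
  qed
  show ?thesis unfolding noninterleaving_def
  proof (intro ballI notI)
    fix e f assume ef: "e \<in> chords" "f \<in> chords" and I: "interleaved c e f"
    obtain i k j l where o: "i < k" "k < j" "j < l" "l < n"
      "(e = {v i, v j} \<and> f = {v k, v l}) \<or> (f = {v i, v j} \<and> e = {v k, v l})"
      using interleaved_index[OF I] .
    have *: "\<not> path_image (g {v i, v j}) - cycle_image g c \<subseteq> D" "\<not> path_image (g {v k, v l}) - cycle_image g c \<subseteq> D"
      if "disc_side (cycle_image g c) D" "R \<subseteq> D" for D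
      using apart[OF that, of "{v i, v j}" i j k l] apart[OF that, of "{v k, v l}" k l j "i + n"] ef o by auto
    have **: "\<not> path_image (g e) - cycle_image g c \<subseteq> D" "\<not> path_image (g f) - cycle_image g c \<subseteq> D"
      if "disc_side (cycle_image g c) D" "R \<subseteq> D" for D
      using *[OF that] o(5) by blast+
    show False
      using Rside
    proof
      assume "R \<subseteq> A"
      then have "path_image (g e) - cycle_image g c \<subseteq> B" "path_image (g f) - cycle_image g c \<subseteq> B"
        using **[OF disc(1)] eside ef by blast+
      then show False using chords_on_same_side[OF emb ef disc(2)] I by blast
    next
      assume "R \<subseteq> B"
      then have "path_image (g e) - cycle_image g c \<subseteq> A" "path_image (g f) - cycle_image g c \<subseteq> A"
        using **[OF disc(2)] eside ef by blast+
      then show False using chords_on_same_side[OF emb ef disc(1)] I by blast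
    qed
  qed
qed

end

context spine_graph
begin

section \<open>Fragments of a Hamiltonian spine\<close>

text \<open>Off the spine, only the open arcs of the chords are left. There are finitely many of them and
  the arcs with their ends are closed and disjoint off the spine, so each open arc is a component.
  Its closure restores the ends.\<close>

lemma fragments_eq_chords:
  assumes emb: "graph_embedding V E UNIV p g"
  shows "fragments V E p g c = (\<lambda>e. path_image (g e)) ` chords"
proof -
  let ?C = "cycle_image g c"
  define W where "W = (\<lambda>e. path_image (g e) - ?C)"
  let ?U = "graph_image V E p g - ?C"
  have "graph_image V E p g = ?C \<union> (\<Union>e\<in>chords. path_image (g e))"
    using vertex_on_spine[OF emb] spine_edges_subset by (auto simp: graph_image_def cycle_image_def)
  then have U: "?U = (\<Union>e\<in>chords. W e)" by (auto simp: W_def)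
  have ne: "W e \<noteq> {}" if "e \<in> chords" for e
    unfolding W_def chord_minus_spine[OF emb that] by simp
  have comp: "W e \<in> components ?U" if e: "e \<in> chords" for e
    unfolding in_components_maximal
  proof (intro conjI allI impI)
    show "W e \<noteq> {}" by (rule ne[OF e])
    show "W e \<subseteq> ?U" using U e by blast
    show "connected (W e)" unfolding W_def by (rule chord_minus_spine_connected[OF emb e])
    fix T assume T: "T \<noteq> {} \<and> W e \<subseteq> T \<and> T \<subseteq> ?U \<and> connected T"
    let ?R = "\<Union>f\<in>chords - {e}. path_image (g f)"
    have cl: "closed (path_image (g f))" if "f \<in> chords" for f
      using emb_arc[OF emb] that by (intro compact_imp_closed compact_arc_image) blast
    have "closed ?R" by (rule closed_UN) (use finite_edges cl in auto)
    moreover have "T \<subseteq> path_image (g e) \<union> ?R"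
    proof
      fix x assume "x \<in> T"
      then obtain f where "f \<in> chords" "x \<in> W f" using T U by blast
      then show "x \<in> path_image (g e) \<union> ?R" by (cases "f = e") (auto simp: W_def)
    qed
    moreover have "path_image (g e) \<inter> ?R \<inter> T = {}"
    proof -
      have "x \<notin> T" if x: "x \<in> path_image (g e)" and f: "f \<in> chords - {e}" "x \<in> path_image (g f)" for x f
      proof
        assume "x \<in> T"
        then have "x \<notin> ?C" using T by blast
        then show False using chord_Int_chord[OF emb e, of f] x f by blast
      qed
      then show ?thesis by blast
    qed
    ultimately have "path_image (g e) \<inter> T = {} \<or> ?R \<inter> T = {}"
      using connected_closedD[of T "path_image (g e)" ?R] T cl[OF e] by blast
    moreover have "path_image (g e) \<inter> T \<noteq> {}" using T ne[OF e] by (auto simp: W_def)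
    ultimately have "T \<subseteq> path_image (g e)" using \<open>T \<subseteq> path_image (g e) \<union> ?R\<close> by blast
    then show "T = W e" using T unfolding W_def by blast
  qed
  have "components ?U = W ` chords"
  proof (intro equalityI subsetI)
    fix K assume K: "K \<in> components ?U"
    then obtain x where "x \<in> K" using in_components_nonempty by blast
    moreover have "K \<subseteq> ?U" using K in_components_subset by blast
    ultimately obtain e where e: "e \<in> chords" "x \<in> W e" using U by blast
    then have "K = W e" using components_eq[OF K comp[OF e(1)]] \<open>x \<in> K\<close> by blast
    then show "K \<in> W ` chords" using e by blast
  qed (use comp in blast)
  moreover have "closure (W e) = path_image (g e)" if "e \<in> chords" for e
    unfolding W_def by (rule closure_chord_minus_spine[OF emb that])
  ultimately show ?thesis unfolding fragments_def by (simp add: image_comp)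
qed

section \<open>From levels to pages\<close>

text \<open>Two points over the same point of the plane differ in height, and the higher one is an
  over-crossing.\<close>

lemma projection_injective:
  assumes "\<not> crosses_over Y Y" shows "inj_on fst Y"
proof (rule inj_onI)
  fix x y assume "x \<in> Y" "y \<in> Y" "fst x = fst y"
  then have "snd x = snd y" using assms unfolding crosses_over_def by (metis linorder_neqE_linordered_idom)
  then show "x = y" using \<open>fst x = fst y\<close> by (simp add: prod_eq_iff)
qed

lemma crosses_over_Un:
  "crosses_over (A \<union> B) D \<longleftrightarrow> crosses_over A D \<or> crosses_over B D"
  "crosses_over D (A \<union> B) \<longleftrightarrow> crosses_over D A \<or> crosses_over D B"
  unfolding crosses_over_def by blast+

text \<open>Without a crossing among the spine and the two chords, the vertical projection embeds these
  three into the plane, with both chords inside the spine.\<close>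

lemma noncrossing_not_interleaved:
  assumes div: "divided_in_levels V E p g c m"
    and e: "e \<in> chords" and f: "f \<in> chords" and "e \<noteq> f"
    and nc: "\<not> crosses_over (path_image (g e)) (path_image (g f))"
      "\<not> crosses_over (path_image (g f)) (path_image (g e))"
  shows "\<not> interleaved c e f"
proof -
  let ?C = "cycle_image g c" and ?E = "insert e (insert f (cycle_edges c))"
  let ?Y = "?C \<union> (path_image (g e) \<union> path_image (g f))"
  have semi: "semi_leveled_diagram V E p g c" and spine: "\<not> crosses_over ?C ?C"
    and bounded: "\<And>A. A \<in> fragments V E p g c \<Longrightarrow> fst ` (A - ?C) \<subseteq> inside (fst ` ?C)"
    using div unfolding divided_in_levels_def by simp_all
  have emb: "graph_embedding V E UNIV p g" using semi unfolding semi_leveled_diagram_def is_diagram_def by blast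
  have frag: "path_image (g e') \<in> fragments V E p g c" if "e' \<in> chords" for e'
    using fragments_eq_chords[OF emb] that by blast
  have self: "\<not> crosses_over A A \<and> \<not> crosses_over A ?C \<and> \<not> crosses_over ?C A"
    if "A \<in> fragments V E p g c" for A using semi that unfolding semi_leveled_diagram_def by blast
  have "\<not> crosses_over ?Y ?Y"
    using nc spine self[OF frag[OF e]] self[OF frag[OF f]] by (simp add: crosses_over_Un)
  then have inj: "inj_on fst ?Y" by (rule projection_injective)
  interpret s: spine_graph V ?E c
    using simple ham e f spine_edges_subset by unfold_locales (auto simp: simple_graph_def hamiltonian_cycle_def is_cycle_def)
  have CY: "?C \<subseteq> ?Y" by blast
  have EY: "path_image (g e') \<subseteq> ?Y" if "e' \<in> ?E" for e'
    using that by (auto simp: cycle_image_def)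
  have "graph_embedding V ?E ?Y p g"
  proof (rule graph_embedding_mono[OF emb _ EY])
    show "?E \<subseteq> E" using e f spine_edges_subset by blast
    show "p ` V \<subseteq> ?Y" using vertex_on_spine[OF emb] by blast
  qed
  then have "graph_embedding V ?E (fst ` ?Y) (fst \<circ> p) (\<lambda>e. fst \<circ> g e)"
    by (rule graph_embedding_image[OF _ _ inj]) (intro continuous_intros)
  then have emb2: "graph_embedding V ?E UNIV (fst \<circ> p) (\<lambda>e. fst \<circ> g e)"
    by (rule graph_embedding_mono) auto
  have C2: "cycle_image (\<lambda>e. fst \<circ> g e) c = fst ` ?C"
    by (auto simp: cycle_image_def path_image_compose)
  have ins: "path_image (fst \<circ> g e') - fst ` ?C \<subseteq> inside (fst ` ?C)" if "e' \<in> chords" for e'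
    using bounded[OF frag[OF that]] by (auto simp: path_image_compose)
  show ?thesis
    by (rule s.chords_inside_not_interleaved[OF emb2, unfolded C2]) (use e f ins in auto)
qed

text \<open>Fragments of level \<open>i > 1\<close> cross over fragments of strictly lower levels only, and the levels
  are disjoint.\<close>

lemma same_level_noncrossing:
  assumes L: "level_partition F m L" and i: "i \<in> {1..m}" and AB: "A \<in> L i" "B \<in> L i" "A \<noteq> B"
  shows "\<not> crosses_over A B"
proof
  assume cross: "crosses_over A B"
  have F: "(\<Union>i\<in>{1..m}. L i) = F" and disj: "disjoint_family_on L {1..m}"
    and L1: "L 1 = {A \<in> F. \<forall>B\<in>F. B \<noteq> A \<longrightarrow> \<not> crosses_over A B}"
    and Li: "\<forall>i\<in>{2..m}. L i = {A \<in> F. (\<exists>B\<in>L (i - 1). crosses_over A B) \<and>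
                               (\<forall>B\<in>F. crosses_over A B \<longrightarrow> (\<exists>k\<in>{1..<i}. B \<in> L k))}"
    using L unfolding level_partition_def by simp_all
  have BF: "B \<in> F" using F AB i by blast
  show False
  proof (cases "i = 1")
    case True
    then have "A \<in> {A \<in> F. \<forall>B\<in>F. B \<noteq> A \<longrightarrow> \<not> crosses_over A B}" using AB(1) L1 by simp
    then show False using BF AB(3) cross by blast
  next
    case False
    then have "i \<in> {2..m}" using i by auto
    note Li' = bspec[OF Li this]
    have "A \<in> {A \<in> F. (\<exists>B\<in>L (i - 1). crosses_over A B) \<and>
        (\<forall>B\<in>F. crosses_over A B \<longrightarrow> (\<exists>k\<in>{1..<i}. B \<in> L k))}" using AB(1) by (subst (asm) Li')
    then have "\<forall>B\<in>F. crosses_over A B \<longrightarrow> (\<exists>k\<in>{1..<i}. B \<in> L k)" by (elim CollectE conjE)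
    then obtain k where "k \<in> {1..<i}" "B \<in> L k" using BF cross by blast
    then have "L k \<inter> L i \<noteq> {}" "k \<noteq> i" "k \<in> {1..m}" using AB(2) i by auto
    then show False using disj i by (auto simp: disjoint_family_on_def)
  qed
qed

text \<open>Different chords give different fragments, so that \<open>same_level_noncrossing\<close> applies to them in
  both orders.\<close>

lemma level_noninterleaving:
  assumes div: "divided_in_levels V E p g c m"
    and L: "level_partition (fragments V E p g c) m L" and i: "i \<in> {1..m}"
  shows "noninterleaving c {e \<in> chords. path_image (g e) \<in> L i}"
  unfolding noninterleaving_def
proof (intro ballI)
  fix e f assume "e \<in> {e \<in> chords. path_image (g e) \<in> L i}" "f \<in> {e \<in> chords. path_image (g e) \<in> L i}"
  then have ef: "e \<in> chords" "f \<in> chords" "path_image (g e) \<in> L i" "path_image (g f) \<in> L i" by auto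
  have emb: "graph_embedding V E UNIV p g"
    using div unfolding divided_in_levels_def semi_leveled_diagram_def is_diagram_def by blast
  show "\<not> interleaved c e f"
  proof (cases "e = f")
    case True then show ?thesis using interleaved_distinct by blast
  next
    case False
    then have "(path_image (g e) - cycle_image g c) \<inter> path_image (g f) = {}"
      using chord_Int_chord[OF emb ef(1,2)] by blast
    moreover have "path_image (g e) - cycle_image g c \<noteq> {}"
      unfolding chord_minus_spine[OF emb ef(1)] by simp
    ultimately have "path_image (g e) \<noteq> path_image (g f)" by blast
    then show ?thesis
      using noncrossing_not_interleaved[OF div ef(1,2) False] same_level_noncrossing[OF L i] ef by metis
  qed
qed

lemma one_level_one_page:
  assumes div: "divided_in_levels V E p g c 1"
  shows "noninterleaving c chords"
proof -
  obtain L where L: "level_partition (fragments V E p g c) 1 L"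
    using div unfolding divided_in_levels_def by blast
  have emb: "graph_embedding V E UNIV p g"
    using div unfolding divided_in_levels_def semi_leveled_diagram_def is_diagram_def by blast
  have "(\<Union>i\<in>{1..1::nat}. L i) = fragments V E p g c" using L unfolding level_partition_def by blast
  then have "{e \<in> chords. path_image (g e) \<in> L 1} = chords"
    using fragments_eq_chords[OF emb] by auto
  then show ?thesis using level_noninterleaving[OF div L, of 1] by simp
qed

lemma two_levels_two_page:
  assumes div: "divided_in_levels V E p g c m" and "m \<le> 2"
  shows "\<exists>F. noninterleaving c F \<and> noninterleaving c (chords - F)"
proof -
  obtain L where L: "level_partition (fragments V E p g c) m L"
    using div unfolding divided_in_levels_def by blast
  have emb: "graph_embedding V E UNIV p g"
    using div unfolding divided_in_levels_def semi_leveled_diagram_def is_diagram_def by blast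
  have m: "1 \<le> m" and U: "(\<Union>i\<in>{1..m}. L i) = fragments V E p g c"
    using L unfolding level_partition_def by blast+
  let ?F = "\<lambda>i. {e \<in> chords. path_image (g e) \<in> L i}"
  show ?thesis
  proof (cases "m = 1")
    case True
    then have "noninterleaving c chords" using one_level_one_page div by blast
    then show ?thesis by (intro exI[of _ chords]) (simp only: Diff_cancel, simp add: noninterleaving_def)
  next
    case False
    then have m2: "m = 2" using m \<open>m \<le> 2\<close> by simp
    have sub: "chords - ?F 1 \<subseteq> ?F 2"
    proof
      fix e assume e: "e \<in> chords - ?F 1"
      then have "path_image (g e) \<in> (\<Union>i\<in>{1..m}. L i)" using U fragments_eq_chords[OF emb] by blast
      then obtain i where "i \<in> {1..2}" "path_image (g e) \<in> L i" using m2 by blast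
      moreover have "i \<noteq> 1" using calculation e by blast
      ultimately have "path_image (g e) \<in> L 2" by (auto simp: le_Suc_eq numeral_2_eq_2)
      then show "e \<in> ?F 2" using e by blast
    qed
    have nF: "noninterleaving c (?F 1)" "noninterleaving c (?F 2)"
      by (rule level_noninterleaving[OF div L], simp add: m2)+
    have mono: "noninterleaving c S" if "noninterleaving c T" "S \<subseteq> T" for S T
      using that unfolding noninterleaving_def by (meson subsetD)
    show ?thesis by (intro exI[of _ "?F 1"] conjI nF(1) mono[OF nF(2) sub])
  qed
qed

end

section \<open>The Hamiltonian level number\<close>

text \<open>Infima of extended naturals are attained, which turns the level numbers back into existence
  statements. The bound has to be finite: the infimum of the empty set is \<open>\<infinity>\<close>.\<close>

lemma enat_Inf_le_iff: "Inf A \<le> enat m \<longleftrightarrow> (\<exists>a\<in>A. a \<le> enat m)"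
proof
  assume le: "Inf A \<le> enat m"
  then have "A \<noteq> {}" by (auto simp: Inf_enat_def)
  then have "Inf A \<in> A" unfolding Inf_enat_def by (auto intro: LeastI)
  then show "\<exists>a\<in>A. a \<le> enat m" using le by blast
qed (meson Inf_lower2)

lemma inv_stereographic_norm: "norm (inv_stereographic x) = 1"
proof -
  define r where "r = (norm x)\<^sup>2"
  have r: "r \<ge> 0" "r + 1 \<noteq> 0" by (auto simp: r_def add_nonneg_eq_0_iff)
  have "(norm (inv_stereographic x))\<^sup>2 = (2 / (r + 1) * norm x)\<^sup>2 + ((r - 1) / (r + 1))\<^sup>2"
    using r by (simp add: inv_stereographic_def norm_Pair r_def[symmetric]) (simp add: power_divide)
  also have "\<dots> = (4 * r + (r - 1)\<^sup>2) / (r + 1)\<^sup>2"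
    by (simp add: power_mult_distrib power_divide flip: r_def add_divide_distrib)
  also have "4 * r + (r - 1)\<^sup>2 = (r + 1)\<^sup>2" by (simp add: power2_eq_square algebra_simps)
  finally have "(norm (inv_stereographic x))\<^sup>2 = 1\<^sup>2" using r by simp
  then show ?thesis by (metis norm_ge_zero power2_eq_imp_eq zero_le_one)
qed

lemma inv_stereographic_inj: "inj inv_stereographic"
proof (rule injI)
  fix x y :: space3 assume eq: "inv_stereographic x = inv_stereographic y"
  define r s where "r = (norm x)\<^sup>2" and "s = (norm y)\<^sup>2"
  have pos: "r + 1 > 0" "s + 1 > 0" unfolding r_def s_def by (auto intro: add_nonneg_pos)
  have 1: "(2 / (r + 1)) *\<^sub>R x = (2 / (s + 1)) *\<^sub>R y" and 2: "(r - 1) / (r + 1) = (s - 1) / (s + 1)"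
    using eq by (simp_all add: inv_stereographic_def r_def s_def)
  have "r = s" using 2 pos by (simp add: field_simps)
  then show "x = y" using 1 pos by simp
qed

lemma inv_stereographic_continuous: "continuous_on A inv_stereographic"
proof -
  have "(norm x)\<^sup>2 + 1 \<noteq> 0" for x :: space3
    by (metis add_nonneg_pos less_irrefl zero_le_power2 zero_less_one)
  then show ?thesis unfolding inv_stereographic_def by (intro continuous_intros) auto
qed

lemma ambient_isotopy_end_id: "ambient_isotopy_end id"
  unfolding ambient_isotopy_end_def
  by (simp add: homotopic_with_refl)

text \<open>The isotopy and the passage to the 3-sphere disappear when minimising over all embeddings: a
  diagram is itself a representative of the spatial graph that it depicts.\<close>

lemma hamiltonian_level_number_le_iff:
  "hamiltonian_level_number V E \<le> enat m \<longleftrightarrow>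
     (\<exists>c p g k. hamiltonian_cycle V E c \<and> k \<le> m \<and> divided_in_levels V E p g c k)" (is "?L \<longleftrightarrow> ?R")
proof
  assume ?L
  then show ?R
    unfolding hamiltonian_level_number_def spatial_hamiltonian_level_number_def enat_Inf_le_iff leveled_def
    by (auto simp: enat_Inf_le_iff) blast
next
  assume ?R
  then obtain c p g k where c: "hamiltonian_cycle V E c" and k: "k \<le> m" and div: "divided_in_levels V E p g c k" by blast
  let ?p = "inv_stereographic \<circ> p" and ?g = "\<lambda>e. inv_stereographic \<circ> g e"
  have "graph_embedding V E UNIV p g"
    using div unfolding divided_in_levels_def semi_leveled_diagram_def is_diagram_def by blast
  then have "graph_embedding V E (inv_stereographic ` UNIV) ?p ?g"
    by (rule graph_embedding_image[OF _ inv_stereographic_continuous inv_stereographic_inj])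
  then have emb: "graph_embedding V E sphere3 ?p ?g"
    by (rule graph_embedding_mono) (auto simp: path_image_def inv_stereographic_norm)
  have "ambient_isotopic V E ?p ?g ?p ?g"
    unfolding ambient_isotopic_def using ambient_isotopy_end_id by (intro exI[of _ id]) simp
  then have "leveled V E ?p ?g c k" unfolding leveled_def using div by blast
  then have "spatial_hamiltonian_level_number V E ?p ?g \<le> enat m"
    unfolding spatial_hamiltonian_level_number_def enat_Inf_le_iff using c k enat_ord_simps(1) by blast
  then show ?L unfolding hamiltonian_level_number_def enat_Inf_le_iff using emb by blast
qed

lemma hamiltonian_level_number_ge_1: "1 \<le> hamiltonian_level_number V E"
proof -
  have "1 \<le> enat k" if "leveled V E p g c k" for p g c k
  proof -
    have "k \<ge> 1" using that unfolding leveled_def divided_in_levels_def level_partition_def by blast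
    then show ?thesis by (simp add: one_enat_def)
  qed
  then show ?thesis
    unfolding hamiltonian_level_number_def spatial_hamiltonian_level_number_def
    by (auto intro!: Inf_greatest)
qed

section \<open>Chords of a regular polygon\<close>

text \<open>The point at position \<open>x\<close> on the unit circle, when a full turn has length \<open>N\<close>. Integer
  positions are the corners of a regular \<open>N\<close>-gon, real positions in between parametrise the spine.\<close>

definition rim :: "nat \<Rightarrow> real \<Rightarrow> complex" where
  "rim N x = cis (2 * pi * x / real N)"

lemma norm_rim [simp]: "cmod (rim N x) = 1" by (simp add: rim_def)

lemma continuous_rim [continuous_intros]:
  "continuous_on A f \<Longrightarrow> continuous_on A (\<lambda>x. rim N (f x))"
  unfolding rim_def cis_conv_exp divide_inverse by (intro continuous_intros)

lemma rim_eq: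
  assumes eq: "rim N x = rim N y" and N: "0 < N" and x: "0 \<le> x" "x \<le> N" and y: "0 \<le> y" "y \<le> N"
  shows "x = y \<or> (x = 0 \<and> y = N) \<or> (x = N \<and> y = 0)"
proof -
  have "cos (2 * pi * x / N) = cos (2 * pi * y / N)" "sin (2 * pi * x / N) = sin (2 * pi * y / N)"
    using eq by (auto simp: rim_def complex_eq_iff)
  then obtain m :: int where "2 * pi * x / N = 2 * pi * y / N + 2 * pi * m"
    using sin_cos_eq_iff by blast
  then have "2 * pi * x / N = 2 * pi * ((y + real_of_int m * real N) / N)" using N by (simp add: field_simps)
  then have "(2 * pi) * (x / N) = (2 * pi) * ((y + real_of_int m * real N) / N)" by simp
  then have "x / N = (y + real_of_int m * real N) / N" by (subst (asm) mult_cancel_left) simp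
  then have m: "x = y + real_of_int m * real N" using N by simp
  then have "\<bar>real_of_int m * real N\<bar> \<le> 1 * real N" using x y by linarith
  then have "\<bar>real_of_int m\<bar> \<le> 1" using N by (simp add: abs_mult)
  then have "m = 0 \<or> m = 1 \<or> m = -1" by linarith
  then show ?thesis using m x y by auto
qed

lemma rim_full_turn: "0 < N \<Longrightarrow> rim N (real N) = rim N 0"
  by (simp add: rim_def)

lemma rim_surj:
  assumes "cmod z = 1" and N: "0 < N" obtains x where "0 \<le> x" "x < real N" "z = rim N x"
proof -
  have "z = cis (Arg2pi z)" using Arg2pi_eq[of z] assms by (simp add: cis_conv_exp)
  moreover have "0 \<le> Arg2pi z" "Arg2pi z < 2 * pi" by (auto simp: Arg2pi_ge_0 Arg2pi_lt_2pi)
  ultimately show ?thesis using N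
    by (intro that[of "Arg2pi z * N / (2 * pi)"]) (auto simp: rim_def field_simps)
qed

text \<open>The affine function whose zero set is the line through the corners \<open>i\<close> and \<open>j\<close>: the chord
  is perpendicular to the direction of the midpoint of its circular arc, at the signed distance
  \<open>cos (pi * (j - i) / N)\<close> from the centre.\<close>

definition chord_side :: "nat \<Rightarrow> nat \<Rightarrow> nat \<Rightarrow> complex \<Rightarrow> real" where
  "chord_side N i j z = Re (z * cis (- (pi * (real i + real j) / N))) - cos (pi * (real j - real i) / N)"

text \<open>The sum-to-product formula exhibits the sign of the function at every corner.\<close>

lemma chord_side_rim:
  assumes "0 < N"
  shows "chord_side N i j (rim N k) = 2 * sin (pi * (real k - real i) / N) * sin (pi * (real j - real k) / N)"
proof -
  let ?a = "pi * (real k - real i) / N" and ?b = "pi * (real j - real k) / N"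
  have 1: "2 * pi * real k / N + - (pi * (real i + real j) / N) = ?a - ?b"
    and 2: "pi * (real j - real i) / N = ?a + ?b"
    using assms by (auto simp: field_simps)
  have "chord_side N i j (rim N k) = cos (?a - ?b) - cos (?a + ?b)"
    unfolding chord_side_def rim_def cis_mult 1 2 by simp
  then show ?thesis by (simp add: cos_add cos_diff)
qed

lemma sin_window:
  assumes "0 < x" "x < real N" shows "sin (pi * x / N) > 0"
proof (rule sin_gt_zero)
  show "0 < pi * x / N" using assms by simp
  have "x / N < 1" using assms by simp
  then have "pi * (x / N) < pi * 1" using pi_gt_zero by (intro mult_strict_left_mono)
  then show "pi * x / N < pi" by simp
qed

lemma chord_side_cases:
  assumes ij: "i < j" "j < N" and k: "k < N"
  shows "chord_side N i j (rim N k) = 0 \<longleftrightarrow> k = i \<or> k = j"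
    and "chord_side N i j (rim N k) > 0 \<longleftrightarrow> i < k \<and> k < j"
    and "chord_side N i j (rim N k) < 0 \<longleftrightarrow> k < i \<or> j < k"
proof -
  have N: "0 < N" using ij by linarith
  let ?s = "\<lambda>x. sin (pi * x / N)"
  have neg: "?s (- x) = - ?s x" for x by simp
  note S = chord_side_rim[OF N, of i j k]
  have mid: "chord_side N i j (rim N k) > 0" if "i < k" "k < j"
  proof -
    have "?s (real k - real i) > 0" "?s (real j - real k) > 0" using that ij by (auto intro!: sin_window)
    then show ?thesis using S by simp
  qed
  have low: "chord_side N i j (rim N k) < 0" if "k < i"
  proof -
    have "?s (real i - real k) > 0" "?s (real j - real k) > 0" using that ij by (auto intro!: sin_window)
    moreover have "?s (real k - real i) = - ?s (real i - real k)" using neg[of "real i - real k"] by simp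
    ultimately have "?s (real k - real i) * ?s (real j - real k) < 0" by (simp add: mult_neg_pos)
    then show ?thesis unfolding S by (simp add: mult.commute)
  qed
  have high: "chord_side N i j (rim N k) < 0" if "j < k"
  proof -
    have "?s (real k - real i) > 0" "?s (real k - real j) > 0" using that ij k by (auto intro!: sin_window)
    moreover have "?s (real j - real k) = - ?s (real k - real j)" using neg[of "real k - real j"] by simp
    ultimately have "?s (real k - real i) * ?s (real j - real k) < 0" by (simp add: mult_pos_neg)
    then show ?thesis unfolding S by (simp add: mult.commute)
  qed
  have ends: "chord_side N i j (rim N k) = 0" if "k = i \<or> k = j" using that S by auto
  consider "k < i" | "k = i \<or> k = j" | "i < k" "k < j" | "j < k" by linarith
  then have "(chord_side N i j (rim N k) = 0 \<longleftrightarrow> k = i \<or> k = j) \<and>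
    (chord_side N i j (rim N k) > 0 \<longleftrightarrow> i < k \<and> k < j) \<and>
    (chord_side N i j (rim N k) < 0 \<longleftrightarrow> k < i \<or> j < k)"
  proof cases
    case 1 then show ?thesis using low ij by auto
  next
    case 2 then show ?thesis using ends ij by auto
  next
    case 3 then show ?thesis using mid by auto
  next
    case 4 then show ?thesis using high ij by auto
  qed
  then show "chord_side N i j (rim N k) = 0 \<longleftrightarrow> k = i \<or> k = j"
    and "chord_side N i j (rim N k) > 0 \<longleftrightarrow> i < k \<and> k < j"
    and "chord_side N i j (rim N k) < 0 \<longleftrightarrow> k < i \<or> j < k" by blast+
qed

lemma chord_side_linepath:
  "chord_side N i j (linepath a b t) = (1 - t) * chord_side N i j a + t * chord_side N i j b"
  by (simp add: chord_side_def linepath_def algebra_simps)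

lemma chord_side_on_chord:
  assumes "i < j" "j < N"
  shows "chord_side N i j (linepath (rim N i) (rim N j) s) = 0"
  using assms chord_side_cases(1)[OF assms, of i] chord_side_cases(1)[OF assms, of j]
  by (simp add: chord_side_linepath)

text \<open>On the second segment the side function of the first is affine and vanishes at the common
  point. Either its signs at the two ends are strictly opposite, which means that the chords
  alternate, or both ends are weakly on one side, and then it can only vanish at an end.\<close>

lemma polygon_chords_meet:
  assumes ij: "i < j" "j < N" and kl: "k < l" "l < N" and ne: "(i, j) \<noteq> (k, l)" and t: "t \<in> {0..1}"
    and eq: "linepath (rim N i) (rim N j) s = linepath (rim N k) (rim N l) t"
  shows "(i < k \<and> k < j \<and> j < l) \<or> (k < i \<and> i < l \<and> l < j) \<or>
     linepath (rim N k) (rim N l) t \<in> {rim N k, rim N l}"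
proof -
  let ?k = "chord_side N i j (rim N k)" and ?l = "chord_side N i j (rim N l)"
  have 0: "(1 - t) * ?k + t * ?l = 0"
    using chord_side_on_chord[OF ij, of s] unfolding eq chord_side_linepath .
  note ck = chord_side_cases[OF ij, of k] and cl = chord_side_cases[OF ij, of l]
  have kN: "k < N" using kl by linarith
  show ?thesis
  proof (cases "?k * ?l < 0")
    case True
    then have "(?k > 0 \<and> ?l < 0) \<or> (?k < 0 \<and> ?l > 0)" by (auto simp: mult_less_0_iff)
    then show ?thesis using ck[OF kN] cl[OF kl(2)] kl by auto
  next
    case False
    have "\<not> (?k = 0 \<and> ?l = 0)" using ck[OF kN] cl[OF kl(2)] kl ne by auto
    then consider "?k > 0 \<or> ?l > 0" "?k \<ge> 0" "?l \<ge> 0" | "?k < 0 \<or> ?l < 0" "?k \<le> 0" "?l \<le> 0"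
      using False by (auto simp: mult_less_0_iff) linarith+
    then have "(1 - t) * ?k = 0 \<and> t * ?l = 0"
    proof cases
      case 1
      then have "(1 - t) * ?k \<ge> 0" "t * ?l \<ge> 0" using t by auto
      then show ?thesis using 0 by linarith
    next
      case 2
      then have "(1 - t) * ?k \<le> 0" "t * ?l \<le> 0" using t by (auto simp: mult_nonneg_nonpos)
      then show ?thesis using 0 by linarith
    qed
    then have "t = 0 \<or> t = 1" using \<open>\<not> (?k = 0 \<and> ?l = 0)\<close> by auto
    then show ?thesis by (auto simp: linepath_def)
  qed
qed

lemma crossing_chords_transverse:
  assumes ij: "i < j" "j < N" and kl: "k < l" "l < N"
    and cross: "(i < k \<and> k < j \<and> j < l) \<or> (k < i \<and> i < l \<and> l < j)"
  shows "chord_side N i j (rim N k) \<noteq> chord_side N i j (rim N l)"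
  using chord_side_cases[OF ij, of k] chord_side_cases[OF ij, of l] cross kl by auto

text \<open>The side function of the first chord is not constant along the second, so it determines the
  parameter of its zero.\<close>

lemma crossing_chords_meet_once:
  assumes ij: "i < j" "j < N" and kl: "k < l" "l < N"
    and cross: "(i < k \<and> k < j \<and> j < l) \<or> (k < i \<and> i < l \<and> l < j)"
    and eq: "linepath (rim N i) (rim N j) s = linepath (rim N k) (rim N l) t"
      "linepath (rim N i) (rim N j) s' = linepath (rim N k) (rim N l) t'"
  shows "t = t'"
proof -
  let ?k = "chord_side N i j (rim N k)" and ?l = "chord_side N i j (rim N l)"
  have "(1 - t) * ?k + t * ?l = 0" "(1 - t') * ?k + t' * ?l = 0"
    using chord_side_on_chord[OF ij] eq by (metis chord_side_linepath)+
  then have "(1 - t) * ?k + t * ?l = (1 - t') * ?k + t' * ?l" by simp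
  then have "(t - t') * (?l - ?k) = 0" by (simp add: algebra_simps)
  then show ?thesis using crossing_chords_transverse[OF ij kl cross] by simp
qed

text \<open>A quantitative form of strict convexity of the disc, valid for all parameters.\<close>

lemma norm_linepath_unit:
  assumes "cmod a = 1" "cmod b = 1"
  shows "(cmod (linepath a b t))\<^sup>2 = 1 - t * (1 - t) * (cmod (a - b))\<^sup>2"
proof -
  have ab: "(Re a)\<^sup>2 + (Im a)\<^sup>2 = 1" "(Re b)\<^sup>2 + (Im b)\<^sup>2 = 1"
    using assms by (metis cmod_power2 one_power2)+
  show ?thesis unfolding cmod_power2 linepath_def
    using ab by (simp add: scaleR_conv_of_real) algebra
qed

lemma linepath_unit_interior:
  assumes "cmod a = 1" "cmod b = 1" "a \<noteq> b" "0 < t" "t < 1"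
  shows "cmod (linepath a b t) < 1"
proof -
  have "t * (1 - t) * (cmod (a - b))\<^sup>2 > 0" using assms by simp
  then have "(cmod (linepath a b t))\<^sup>2 < 1\<^sup>2" using norm_linepath_unit[OF assms(1,2), of t] by simp
  then show ?thesis by (rule power2_less_imp_less) simp
qed

section \<open>Transversality of straight segments\<close>

text \<open>The functional \<open>z \<mapsto> Re (z * u)\<close> vanishes on \<open>b\<close> but not on \<open>d\<close>. If the determinant of the two
  vectors were zero, \<open>d\<close> would be a real multiple of \<open>b\<close>.\<close>

lemma independent_imp_det:
  fixes b d u :: complex
  assumes "b \<noteq> 0" "Re (b * u) = 0" "Re (d * u) \<noteq> 0"
  shows "Im (cnj b * d) \<noteq> 0"
proof
  assume "Im (cnj b * d) = 0"
  then have "cnj b * d = of_real (Re (cnj b * d))" by (simp add: complex_eq_iff)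
  then have "(b * cnj b) * d = of_real (Re (cnj b * d)) * b" by (metis mult.assoc mult.commute)
  then have "of_real ((cmod b)\<^sup>2) * d = of_real (Re (cnj b * d)) * b" by (simp only: complex_norm_square)
  moreover have Re_scale: "Re (of_real r * w) = r * Re w" for r w by simp
  ultimately have "Re (of_real ((cmod b)\<^sup>2) * d * u) = Re (of_real (Re (cnj b * d)) * b * u)" by simp
  then have "(cmod b)\<^sup>2 * Re (d * u) = Re (cnj b * d) * Re (b * u)"
    by (simp only: mult.assoc Re_scale)
  then show False using assms by simp
qed

lemma interval_affine:
  fixes \<epsilon> :: real
  assumes "0 < \<epsilon>" shows "{s - \<epsilon><..<s + \<epsilon>} = (\<lambda>r. s + \<epsilon> * r) ` {-1<..<1}"
proof (intro equalityI subsetI)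
  fix r assume "r \<in> {s - \<epsilon><..<s + \<epsilon>}"
  then show "r \<in> (\<lambda>r. s + \<epsilon> * r) ` {-1<..<1}"
    using assms by (intro image_eqI[of _ _ "(r - s) / \<epsilon>"]) (auto simp: field_simps)
next
  fix r assume "r \<in> (\<lambda>r. s + \<epsilon> * r) ` {-1<..<1}"
  then obtain q where "q \<in> {-1<..<1}" and r: "r = s + \<epsilon> * q" by blast
  then have "\<epsilon> * q < \<epsilon> * 1" "\<epsilon> * (-1) < \<epsilon> * q"
    using assms by (intro mult_strict_left_mono; simp)+
  then show "r \<in> {s - \<epsilon><..<s + \<epsilon>}" using r by simp
qed

text \<open>The chart is the affine map that takes the two directions to the coordinate axes, scaled by
  \<open>\<epsilon>\<close> so that the pieces of the segments in the chart stay within the parameter interval on either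
  side of the crossing.\<close>

lemma transversal_segments:
  assumes s: "0 < s" "s < 1" and t: "0 < t" "t < 1"
    and eq: "linepath a b s = linepath a' b' t"
    and det: "Im (cnj (b - a) * (b' - a')) \<noteq> 0"
  shows "transversal (linepath a b) s (linepath a' b') t"
proof -
  define \<epsilon> where "\<epsilon> = min (min s (1 - s)) (min t (1 - t))"
  have \<epsilon>: "0 < \<epsilon>" "\<epsilon> \<le> s" "\<epsilon> \<le> 1 - s" "\<epsilon> \<le> t" "\<epsilon> \<le> 1 - t"
    unfolding \<epsilon>_def using s t by auto
  define P where "P = linepath a b s"
  define x y where "x = b - a" and "y = b' - a'"
  define \<Delta> where "\<Delta> = Im (cnj x * y)"
  have \<Delta>: "\<Delta> \<noteq> 0" using det by (simp add: \<Delta>_def x_def y_def)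
  define \<psi> where "\<psi> = (\<lambda>z. P + of_real (\<epsilon> * Re z) * x + of_real (\<epsilon> * Im z) * y)"
  \<comment> \<open>The inverse of \<open>\<psi>\<close> by Cramer's rule.\<close>
  define \<phi> where "\<phi> = (\<lambda>z. Complex (Im (cnj (z - P) * y) / (\<epsilon> * \<Delta>)) (Im (cnj x * (z - P)) / (\<epsilon> * \<Delta>)))"
  have \<phi>\<psi>: "\<phi> (\<psi> z) = z" for z
    using \<epsilon>(1) \<Delta> by (simp add: \<phi>_def \<psi>_def \<Delta>_def complex_eq_iff field_simps)
  have \<psi>\<phi>: "\<psi> (\<phi> z) = z" for z
  proof -
    define q where "q = z - P"
    have "of_real (Im (cnj q * y) / \<Delta>) * x + of_real (Im (cnj x * q) / \<Delta>) * y = q"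
    proof -
      have "of_real (Im (cnj q * y)) * x + of_real (Im (cnj x * q)) * y = of_real \<Delta> * q"
        by (simp add: complex_eq_iff \<Delta>_def algebra_simps)
      moreover have "of_real (Im (cnj q * y) / \<Delta>) * x + of_real (Im (cnj x * q) / \<Delta>) * y
          = (of_real (Im (cnj q * y)) * x + of_real (Im (cnj x * q)) * y) / of_real \<Delta>"
        by (simp only: of_real_divide add_divide_distrib times_divide_eq_left)
      ultimately show ?thesis using \<Delta> by simp
    qed
    moreover have "\<epsilon> * (Im (cnj q * y) / (\<epsilon> * \<Delta>)) = Im (cnj q * y) / \<Delta>" "\<epsilon> * (Im (cnj x * q) / (\<epsilon> * \<Delta>)) = Im (cnj x * q) / \<Delta>"
      using \<epsilon>(1) by auto
    ultimately have "\<psi> (\<phi> z) = P + q"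
      unfolding \<psi>_def \<phi>_def q_def[symmetric] complex.sel by (simp only: add.assoc)
    then show ?thesis by (simp add: q_def)
  qed
  have cont_\<psi>: "continuous_on S \<psi>" for S unfolding \<psi>_def by (intro continuous_intros)
  have cont_\<phi>: "continuous_on S \<phi>" for S
    unfolding \<phi>_def Complex_eq by (intro continuous_intros) (use \<epsilon> \<Delta> in auto)
  define U where "U = \<phi> -` ball 0 1"
  have "open U" unfolding U_def using cont_\<phi> by (intro open_vimage) auto
  moreover have "homeomorphism U (ball 0 1) \<phi> \<psi>"
  proof (rule homeomorphismI)
    show "\<phi> ` U \<subseteq> ball 0 1" by (auto simp: U_def)
    show "\<psi> ` ball 0 1 \<subseteq> U" by (auto simp: U_def \<phi>\<psi>)
  qed (auto simp: cont_\<phi> cont_\<psi> \<phi>\<psi> \<psi>\<phi>)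
  moreover have "0 \<le> s - \<epsilon>" "s - \<epsilon> < s" "s < s + \<epsilon>" "s + \<epsilon> \<le> 1" "0 \<le> t - \<epsilon>" "t - \<epsilon> < t" "t < t + \<epsilon>" "t + \<epsilon> \<le> 1"
    using \<epsilon> by auto
  moreover have P0: "\<psi> 0 = P" by (simp add: \<psi>_def)
  moreover have axis: "linepath a b ` {s - \<epsilon><..<s + \<epsilon>} = \<psi> ` {z \<in> ball 0 1. Im z = 0}"
  proof -
    have lp: "linepath a b (s + \<epsilon> * r) = \<psi> (of_real r)" for r
      by (simp add: linepath_def P_def \<psi>_def x_def scaleR_conv_of_real algebra_simps)
    note interval_affine[OF \<epsilon>(1), of s]
    moreover have "{z \<in> ball 0 1. Im z = 0} = complex_of_real ` {-1<..<1}"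
    proof (intro equalityI subsetI)
      fix z :: complex assume "z \<in> {z \<in> ball 0 1. Im z = 0}"
      then have "z = of_real (Re z)" "\<bar>Re z\<bar> < 1" by (auto simp: complex_eq_iff cmod_eq_Re)
      then show "z \<in> complex_of_real ` {-1<..<1}" by (intro image_eqI[of _ _ "Re z"]) auto
    qed auto
    ultimately show ?thesis by (simp add: image_image lp)
  qed
  moreover have "linepath a' b' ` {t - \<epsilon><..<t + \<epsilon>} = \<psi> ` {z \<in> ball 0 1. Re z = 0}"
  proof -
    have lp: "linepath a' b' (t + \<epsilon> * r) = \<psi> (\<i> * of_real r)" for r
    proof -
      have "linepath a' b' (t + \<epsilon> * r) = linepath a' b' t + of_real (\<epsilon> * r) * y"
        by (simp add: linepath_def y_def scaleR_conv_of_real algebra_simps)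
      then show ?thesis unfolding eq[symmetric] by (simp add: P_def \<psi>_def)
    qed
    note interval_affine[OF \<epsilon>(1), of t]
    moreover have "{z \<in> ball 0 1. Re z = 0} = (\<lambda>r. \<i> * complex_of_real r) ` {-1<..<1}"
    proof (intro equalityI subsetI)
      fix z :: complex assume "z \<in> {z \<in> ball 0 1. Re z = 0}"
      then have "z = \<i> * of_real (Im z)" "\<bar>Im z\<bar> < 1" by (auto simp: complex_eq_iff cmod_eq_Im)
      then show "z \<in> (\<lambda>r. \<i> * complex_of_real r) ` {-1<..<1}" by (intro image_eqI[of _ _ "Im z"]) auto
    qed (auto simp: norm_mult)
    ultimately show ?thesis by (simp add: image_image lp)
  qed
  moreover have "linepath a b s = \<psi> 0" "linepath a' b' t = \<psi> 0" using eq P0 by (simp_all add: P_def)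
  ultimately show ?thesis unfolding transversal_def
    by (intro exI[of _ U] exI[of _ \<phi>] exI[of _ \<psi>] exI[of _ "s - \<epsilon>"] exI[of _ "s + \<epsilon>"]
        exI[of _ "t - \<epsilon>"] exI[of _ "t + \<epsilon>"] conjI) assumption+
qed

lemma transversal_polygon_chords:
  assumes ij: "i < j" "j < N" and kl: "k < l" "l < N"
    and cross: "(i < k \<and> k < j \<and> j < l) \<or> (k < i \<and> i < l \<and> l < j)"
    and s: "0 < s" "s < 1" and t: "0 < t" "t < 1"
    and eq: "linepath (rim N i) (rim N j) s = linepath (rim N k) (rim N l) t"
  shows "transversal (linepath (rim N i) (rim N j)) s (linepath (rim N k) (rim N l)) t"
proof (rule transversal_segments[OF s t eq])
  let ?u = "cis (- (pi * (real i + real j) / N))"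
  have diff: "chord_side N i j z - chord_side N i j z' = Re ((z - z') * ?u)" for z z'
    by (simp add: chord_side_def algebra_simps)
  have iN: "i < N" using ij by linarith
  show "Im (cnj (rim N j - rim N i) * (rim N l - rim N k)) \<noteq> 0"
  proof (rule independent_imp_det[of _ ?u])
    have "rim N i \<noteq> rim N j" using rim_eq[of N i j] ij by auto
    then show "rim N j - rim N i \<noteq> 0" by simp
    show "Re ((rim N j - rim N i) * ?u) = 0"
      using chord_side_cases(1)[OF ij iN] chord_side_cases(1)[OF ij ij(2)] diff[of "rim N j" "rim N i"] by simp
    show "Re ((rim N l - rim N k) * ?u) \<noteq> 0"
      using crossing_chords_transverse[OF ij kl cross] diff[of "rim N l" "rim N k"] by simp
  qed
qed

section \<open>The straight-line drawing in the disc\<close>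

context spine_graph
begin

definition pos :: "'a \<Rightarrow> complex" where
  "pos u = rim n (real (SOME k. k < n \<and> v k = u))"

text \<open>The choices depend on the edge only, as an edge is a set and has no preferred end. Edges of
  the spine follow the circle, chords are straight.\<close>

definition drawing :: "'a set \<Rightarrow> real \<Rightarrow> complex" where
  "drawing e =
     (if e \<in> cycle_edges c then (\<lambda>t. rim n (real (SOME k. k < n \<and> e = step k) + t))
      else (let ij = SOME ij. fst ij < snd ij \<and> snd ij < n \<and> e = {v (fst ij), v (snd ij)}
            in linepath (rim n (real (fst ij))) (rim n (real (snd ij)))))"

text \<open>The case \<open>k = n\<close> is included for the edge of the spine that closes the cycle: it ends at the
  position \<open>n\<close>, which is the position 0 after a full turn.\<close>

lemma pos_vtx: assumes "k \<le> n" shows "pos (v k) = rim n (real k)"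
proof -
  obtain m where "0 \<le> m" "m < 0 + n" "v k = v m" using vertex_obtain_vtx[OF vtx_in] .
  then have m: "m < n" "v m = v k" by simp_all
  define m' where "m' = (SOME m. m < n \<and> v m = v k)"
  have pm: "pos (v k) = rim n (real m')" by (simp add: pos_def m'_def)
  have m': "m' < n" "v m' = v k" using someI[of "\<lambda>m. m < n \<and> v m = v k" m] m by (auto simp: m'_def)
  show ?thesis
  proof (cases "k = n")
    case True
    then have "v m' = v 0" using m' vtx_add_length[of 0] by simp
    then have "m' = 0" using vtx_inj_window[of m' 0 0] m'(1) length_pos by simp
    then show ?thesis using True rim_full_turn[OF length_pos] pm by simp
  next
    case False
    then have "m' = k" using vtx_inj_window[of m' k 0] m' assms by simp
    then show ?thesis using pm by simp
  qed
qed

lemma vertex_pos: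
  assumes "u \<in> V" obtains k where "k < n" "u = v k" "pos u = rim n (real k)"
proof -
  obtain k where "0 \<le> k" "k < 0 + n" "u = v k" using vertex_obtain_vtx[OF assms] .
  then show ?thesis using that[of k] pos_vtx[of k] by simp
qed

lemma norm_pos [simp]: "cmod (pos u) = 1" by (simp add: pos_def)

lemma inj_pos: "inj_on pos V"
proof (rule inj_onI)
  fix u w assume u: "u \<in> V" and w: "w \<in> V" and eq: "pos u = pos w"
  obtain k where k: "k < n" "u = v k" "pos u = rim n (real k)" using vertex_pos[OF u] .
  obtain l where l: "l < n" "w = v l" "pos w = rim n (real l)" using vertex_pos[OF w] .
  have "rim n (real k) = rim n (real l)" using eq k l by simp
  then show "u = w" using rim_eq[OF _ length_pos, of "real k" "real l"] k l by auto
qed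

lemma drawing_cycle:
  assumes "e \<in> cycle_edges c"
  obtains k where "k < n" "e = step k" "drawing e = (\<lambda>t. rim n (real k + t))"
proof -
  define P where "P = (\<lambda>k. k < n \<and> e = step k)"
  obtain k where "P k" using assms cycle_edges_window[of 0] by (auto simp: P_def)
  then have PE: "P (Eps P)" by (rule someI)
  have dest: "k < n \<and> e = step k" if "P k" for k using that by (simp add: P_def)
  have "drawing e = (\<lambda>t. rim n (real (Eps P) + t))" using assms by (simp add: drawing_def P_def)
  then show ?thesis using that dest[OF PE] by blast
qed

lemma drawing_chord:
  assumes "e \<in> chords"
  obtains i j where "i < j" "j < n" "e = {v i, v j}" "drawing e = linepath (rim n (real i)) (rim n (real j))"
proof -
  define P where "P = (\<lambda>ij. fst ij < snd ij \<and> snd ij < n \<and> e = {v (fst ij), v (snd ij)})"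
  obtain i j where "i < j" "j < n" "e = {v i, v j}" using edge_as_vtx_pair[of e] assms by blast
  then have "P (i, j)" by (simp add: P_def)
  then have PE: "P (Eps P)" by (rule someI)
  have dest: "fst ij < snd ij \<and> snd ij < n \<and> e = {v (fst ij), v (snd ij)}" if "P ij" for ij
    using that by (simp add: P_def)
  have "drawing e = linepath (rim n (real (fst (Eps P)))) (rim n (real (snd (Eps P))))"
    using assms by (simp add: drawing_def P_def Let_def)
  then show ?thesis using that dest[OF PE] by blast
qed

lemma drawing_continuous:
  assumes e: "e \<in> E" shows "continuous_on A (drawing e)"
proof (cases "e \<in> cycle_edges c")
  case True
  then obtain k where "drawing e = (\<lambda>t. rim n (real k + t))" using drawing_cycle by metis
  then show ?thesis by (simp add: continuous_intros)
next
  case False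
  then obtain i j where "drawing e = linepath (rim n (real i)) (rim n (real j))"
    using drawing_chord[of e] e by blast
  then show ?thesis by (simp add: linepath_def continuous_intros)
qed

lemma drawing_inj:
  assumes e: "e \<in> E" shows "inj_on (drawing e) {0..1}"
proof (cases "e \<in> cycle_edges c")
  case True
  then obtain k where k: "k < n" "drawing e = (\<lambda>t. rim n (real k + t))" using drawing_cycle by metis
  show ?thesis
  proof (rule inj_onI)
    fix s t :: real assume st: "s \<in> {0..1}" "t \<in> {0..1}" "drawing e s = drawing e t"
    have "real k + 1 \<le> n" using k by linarith
    then have "real k + s = real k + t \<or> (real k + s = 0 \<and> real k + t = n) \<or> (real k + s = n \<and> real k + t = 0)"
      using st k length_pos by (intro rim_eq) auto
    then show "s = t" using st three_le_length by auto
  qed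
next
  case False
  then obtain i j where ij: "i < j" "j < n" "drawing e = linepath (rim n (real i)) (rim n (real j))"
    using drawing_chord[of e] e by blast
  have "rim n (real i) \<noteq> rim n (real j)" using rim_eq[OF _ length_pos, of "real i" "real j"] ij by auto
  then have "arc (drawing e)" using ij by simp
  then show ?thesis by (simp add: arc_def)
qed

lemma drawing_ends:
  assumes e: "e \<in> E" shows "{drawing e 0, drawing e 1} = pos ` e"
proof (cases "e \<in> cycle_edges c")
  case True
  then obtain k where k: "k < n" "e = step k" "drawing e = (\<lambda>t. rim n (real k + t))" using drawing_cycle by metis
  then show ?thesis using pos_vtx[of k] pos_vtx[of "Suc k"] by (simp add: add.commute)
next
  case False
  then obtain i j where ij: "i < j" "j < n" "e = {v i, v j}" "drawing e = linepath (rim n (real i)) (rim n (real j))"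
    using drawing_chord[of e] e by blast
  then show ?thesis using pos_vtx[of i] pos_vtx[of j] by (simp add: linepath_def)
qed

lemma drawing_cycle_norm: "e \<in> cycle_edges c \<Longrightarrow> cmod (drawing e t) = 1"
  using drawing_cycle[of e] by (metis norm_rim)

lemma drawing_chord_norm:
  assumes e: "e \<in> chords" and t: "0 < t" "t < 1" shows "cmod (drawing e t) < 1"
proof -
  obtain i j where ij: "i < j" "j < n" "drawing e = linepath (rim n (real i)) (rim n (real j))"
    using drawing_chord[OF e] by metis
  have "rim n (real i) \<noteq> rim n (real j)" using rim_eq[OF _ length_pos, of "real i" "real j"] ij by auto
  then show ?thesis using linepath_unit_interior[OF norm_rim norm_rim _ t] ij by simp
qed

lemma drawing_end_vertex:
  assumes "e \<in> E" "t = 0 \<or> t = 1" obtains u where "u \<in> e" "u \<in> V" "drawing e t = pos u"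
proof -
  have "drawing e t \<in> pos ` e" using drawing_ends[OF assms(1)] assms(2) by blast
  then show ?thesis using that edge_subset[OF assms(1)] by blast
qed

lemma drawing_norm_le:
  assumes e: "e \<in> E" and t: "t \<in> {0..1}" shows "cmod (drawing e t) \<le> 1"
proof (cases "t = 0 \<or> t = 1")
  case True
  then obtain u where "drawing e t = pos u" using drawing_end_vertex[OF e] by metis
  then show ?thesis by simp
next
  case False
  then have "0 < t" "t < 1" using t by auto
  then show ?thesis using drawing_cycle_norm[of e t] drawing_chord_norm[of e t] e
    by (cases "e \<in> cycle_edges c") auto
qed

lemma drawing_on_circle:
  assumes "e \<in> E" "t \<in> {0..1}" "cmod (drawing e t) = 1"
  shows "e \<in> cycle_edges c \<or> t = 0 \<or> t = 1"
  using drawing_chord_norm[of e t] assms by force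

text \<open>On a chord only the ends have norm 1. On an edge of the spine the position of a vertex is an
  integer, while the interior of the edge lies strictly between two consecutive ones.\<close>

lemma drawing_vertex:
  assumes e: "e \<in> E" and u: "u \<in> V" and t: "t \<in> {0..1}" and eq: "pos u = drawing e t"
  shows "u \<in> e"
proof (cases "t = 0 \<or> t = 1")
  case True
  then obtain w where "w \<in> e" "w \<in> V" "drawing e t = pos w" using drawing_end_vertex[OF e] by metis
  then show ?thesis using inj_pos u eq by (metis inj_on_eq_iff)
next
  case False
  then have t': "0 < t" "t < 1" using t by auto
  have "e \<in> cycle_edges c" using drawing_on_circle[OF e t] False norm_pos[of u] unfolding eq by blast
  then obtain k where k: "k < n" "e = step k" "drawing e = (\<lambda>t. rim n (real k + t))" using drawing_cycle by metis
  obtain m where m: "m < n" "u = v m" "pos u = rim n (real m)" using vertex_pos[OF u] .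
  have kn: "real k + 1 \<le> real n" using k by linarith
  have "real m = real k + t \<or> (real m = 0 \<and> real k + t = real n) \<or> (real m = real n \<and> real k + t = 0)"
    using eq k m length_pos kn t' by (intro rim_eq) auto
  then have "real m = real k + t" using t' kn m by auto
  then have "k < m" "m < Suc k" using t' by linarith+
  then show ?thesis by simp
qed

text \<open>If neither parameter is an end, both edges belong to the spine and occupy the same open unit
  interval of positions.\<close>

lemma drawing_meet_on_circle:
  assumes ef: "e \<in> E" "f \<in> E" "e \<noteq> f" and st: "s \<in> {0..1}" "t \<in> {0..1}"
    and eq: "drawing e s = drawing f t" and circ: "cmod (drawing e s) = 1"
  shows "drawing e s \<in> pos ` (e \<inter> f)"
proof -
  have "\<exists>u\<in>V. drawing e s = pos u"
  proof (cases "(s = 0 \<or> s = 1) \<or> (t = 0 \<or> t = 1)")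
    case True
    then show ?thesis using drawing_end_vertex[OF ef(1), of s] drawing_end_vertex[OF ef(2), of t] eq by metis
  next
    case False
    then have "e \<in> cycle_edges c" "f \<in> cycle_edges c"
      using drawing_on_circle[OF ef(1) st(1) circ] drawing_on_circle[OF ef(2) st(2)] circ eq by auto
    then obtain k l where k: "k < n" "e = step k" "drawing e = (\<lambda>t. rim n (real k + t))"
      and l: "l < n" "f = step l" "drawing f = (\<lambda>t. rim n (real l + t))" using drawing_cycle by metis
    have kn: "real k + 1 \<le> real n" "real l + 1 \<le> real n" using k l by linarith+
    have st': "0 < s" "s < 1" "0 < t" "t < 1" using False st by auto
    have "real k + s = real l + t \<or> (real k + s = 0 \<and> real l + t = n) \<or> (real k + s = n \<and> real l + t = 0)"
      using eq k l length_pos kn st' by (intro rim_eq) auto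
    then have "real k + s = real l + t" using st' kn by auto
    then have "k = l" using st' by linarith
    then show ?thesis using k l ef by simp
  qed
  then obtain u where u: "u \<in> V" "drawing e s = pos u" by blast
  then have "u \<in> e" "u \<in> f" using drawing_vertex ef st eq by metis+
  then show ?thesis using u by blast
qed

lemma drawing_meet_inside:
  assumes ef: "e \<in> E" "f \<in> E" "e \<noteq> f" and st: "s \<in> {0..1}" "t \<in> {0..1}"
    and eq: "drawing e s = drawing f t" and circ: "cmod (drawing e s) < 1"
  obtains i j k l where "i < j" "j < n" "k < l" "l < n"
    "drawing e = linepath (rim n (real i)) (rim n (real j))" "drawing f = linepath (rim n (real k)) (rim n (real l))"
    "(i < k \<and> k < j \<and> j < l) \<or> (k < i \<and> i < l \<and> l < j)"
    "e \<in> chords" "f \<in> chords" "0 < s" "s < 1" "0 < t" "t < 1" "interleaved c e f"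
proof -
  have ch: "e \<in> chords" "f \<in> chords" using drawing_cycle_norm[of e s] drawing_cycle_norm[of f t] circ eq ef by auto
  obtain i j where ij: "i < j" "j < n" "e = {v i, v j}" "drawing e = linepath (rim n (real i)) (rim n (real j))"
    using drawing_chord[OF ch(1)] .
  obtain k l where kl: "k < l" "l < n" "f = {v k, v l}" "drawing f = linepath (rim n (real k)) (rim n (real l))"
    using drawing_chord[OF ch(2)] .
  have "s \<noteq> 0 \<and> s \<noteq> 1" using drawing_end_vertex[OF ef(1), of s] circ by (metis norm_pos less_irrefl)
  moreover have "t \<noteq> 0 \<and> t \<noteq> 1" using drawing_end_vertex[OF ef(2), of t] circ eq by (metis norm_pos less_irrefl)
  ultimately have st': "0 < s" "s < 1" "0 < t" "t < 1" using st by auto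
  have "(i, j) \<noteq> (k, l)" using ij kl ef by auto
  moreover have "linepath (rim n (real k)) (rim n (real l)) t \<notin> {rim n (real k), rim n (real l)}"
    using circ eq kl by (metis norm_rim insert_iff empty_iff less_irrefl)
  ultimately have cross: "(i < k \<and> k < j \<and> j < l) \<or> (k < i \<and> i < l \<and> l < j)"
    using polygon_chords_meet[OF ij(1,2) kl(1,2) _ st(2)] eq ij(4) kl(4) by metis
  have nth: "v i = c ! i" "v j = c ! j" "v k = c ! k" "v l = c ! l" using ij kl by (auto simp: vtx_nth)
  have "interleaved c e f"
    using cross
  proof
    assume "i < k \<and> k < j \<and> j < l"
    then show ?thesis unfolding interleaved_def ij(3) kl(3) nth
      by (intro exI[of _ i] exI[of _ k] exI[of _ j] exI[of _ l]) (use kl in simp)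
  next
    assume "k < i \<and> i < l \<and> l < j"
    then show ?thesis unfolding interleaved_def ij(3) kl(3) nth
      by (intro exI[of _ k] exI[of _ i] exI[of _ l] exI[of _ j]) (use ij in \<open>simp add: insert_commute\<close>)
  qed
  then show ?thesis using that ij kl cross ch st' by blast
qed

lemma drawing_meet_once:
  assumes ef: "e \<in> E" "f \<in> E" "e \<noteq> f" and st: "s \<in> {0..1}" "t \<in> {0..1}" "s' \<in> {0..1}" "t' \<in> {0..1}"
    and eq: "drawing e s = drawing f t" "drawing e s' = drawing f t'" and circ: "cmod (drawing e s) < 1"
  shows "t = t'"
proof -
  obtain i j k l where *: "i < j" "j < n" "k < l" "l < n"
    "drawing e = linepath (rim n (real i)) (rim n (real j))" "drawing f = linepath (rim n (real k)) (rim n (real l))"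
    "(i < k \<and> k < j \<and> j < l) \<or> (k < i \<and> i < l \<and> l < j)"
    using drawing_meet_inside[OF ef st(1,2) eq(1) circ] by metis
  show ?thesis using crossing_chords_meet_once[OF *(1-4,7)] eq unfolding *(5,6) by blast
qed

end

section \<open>The hemisphere embedding\<close>

text \<open>The point of the unit sphere over a point \<open>z\<close> of the disc, on the upper hemisphere for
  \<open>\<sigma> = 1\<close> and on the lower one for \<open>\<sigma> = -1\<close>; the hemispheres agree over the unit circle.\<close>

definition hemisphere_lift :: "real \<Rightarrow> complex \<Rightarrow> space3" where
  "hemisphere_lift \<sigma> z = (z, \<sigma> * sqrt (1 - (cmod z)\<^sup>2))"

lemma fst_hemisphere_lift [simp]: "fst (hemisphere_lift \<sigma> z) = z"
  by (simp add: hemisphere_lift_def)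

lemma hemisphere_lift_rim: "cmod z = 1 \<Longrightarrow> hemisphere_lift \<sigma> z = (z, 0)"
  by (simp add: hemisphere_lift_def)

lemma continuous_hemisphere_lift: "continuous_on A (hemisphere_lift \<sigma>)"
  unfolding hemisphere_lift_def by (intro continuous_intros)

lemma hemisphere_lift_in_sphere:
  assumes "cmod z \<le> 1" "\<sigma> = 1 \<or> \<sigma> = -1"
  shows "hemisphere_lift \<sigma> z \<in> sphere2"
proof -
  have "(cmod z)\<^sup>2 \<le> 1" using assms by (simp add: power_le_one)
  moreover have "\<sigma>\<^sup>2 = 1" using assms by auto
  ultimately have "(cmod z)\<^sup>2 + (\<sigma> * sqrt (1 - (cmod z)\<^sup>2))\<^sup>2 = 1"
    by (simp add: power_mult_distrib)
  then show ?thesis by (simp add: hemisphere_lift_def norm_Pair)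
qed

lemma sphere2_snd: "x \<in> sphere2 \<Longrightarrow> (snd x)\<^sup>2 = 1 - (cmod (fst x))\<^sup>2"
  by (cases x) (simp add: norm_Pair)

text \<open>A vertical line meets the sphere at most twice, so the projection of a graph on the sphere has
  no triple points.\<close>

lemma sphere2_fibre:
  assumes "x \<in> sphere2" "y \<in> sphere2" "fst x = fst y"
  shows "y = x \<or> snd y = - snd x"
proof -
  have "(snd y)\<^sup>2 = (snd x)\<^sup>2" using assms sphere2_snd by metis
  then show ?thesis using assms(3) by (auto simp: power2_eq_iff prod_eq_iff)
qed

context spine_graph
begin

text \<open>The set \<open>F\<close> is the lower page. The sign of an edge of the spine is immaterial, since this edge
  is lifted to the equator in either case.\<close>

definition hemi_sign :: "'a set set \<Rightarrow> 'a set \<Rightarrow> real" where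
  "hemi_sign F e = (if e \<in> F then -1 else 1)"

definition hemi_vertex :: "'a \<Rightarrow> space3" where "hemi_vertex u = (pos u, 0)"

definition hemi_edge :: "'a set set \<Rightarrow> 'a set \<Rightarrow> real \<Rightarrow> space3" where
  "hemi_edge F e = hemisphere_lift (hemi_sign F e) \<circ> drawing e"

lemma fst_hemi_edge [simp]: "fst (hemi_edge F e t) = drawing e t"
  by (simp add: hemi_edge_def)

lemma fst_comp_hemi_edge [simp]: "fst \<circ> hemi_edge F e = drawing e"
  by (simp add: fun_eq_iff)

lemma hemi_sign_cases: "hemi_sign F e = 1 \<or> hemi_sign F e = -1"
  by (simp add: hemi_sign_def)

lemma hemi_edge_sphere: "\<lbrakk>e \<in> E; t \<in> {0..1}\<rbrakk> \<Longrightarrow> hemi_edge F e t \<in> sphere2"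
  unfolding hemi_edge_def comp_def
  by (rule hemisphere_lift_in_sphere) (use drawing_norm_le hemi_sign_cases in auto)

lemma hemi_edge_on_circle: "cmod (drawing e t) = 1 \<Longrightarrow> hemi_edge F e t = (drawing e t, 0)"
  by (simp add: hemi_edge_def hemisphere_lift_rim)

lemma path_image_hemi_edge: "path_image (hemi_edge F e) = hemi_edge F e ` {0..1}"
  by (simp add: path_image_def)

text \<open>Different points over the same point of the disc lie on opposite hemispheres, off the
  equator.\<close>

lemma hemi_edge_over:
  assumes ef: "e \<in> E" "f \<in> E" and st: "s \<in> {0..1}" "t \<in> {0..1}"
    and eq: "drawing e s = drawing f t" and ne: "hemi_edge F e s \<noteq> hemi_edge F f t"
  shows "hemi_sign F e \<noteq> hemi_sign F f" "e \<noteq> f" "cmod (drawing e s) < 1"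
proof -
  show 1: "hemi_sign F e \<noteq> hemi_sign F f" using ne eq by (auto simp: hemi_edge_def)
  then show "e \<noteq> f" by blast
  have "cmod (drawing e s) \<noteq> 1"
    using ne eq hemi_edge_on_circle[of e s F] hemi_edge_on_circle[of f t F] by auto
  then show "cmod (drawing e s) < 1" using drawing_norm_le[OF ef(1) st(1)] by simp
qed

lemma hemi_edge_snd_pos:
  assumes "e \<in> E" "t \<in> {0..1}"
  shows "hemi_sign F e * snd (hemi_edge F e t) \<ge> 0"
proof -
  have "(cmod (drawing e t))\<^sup>2 \<le> 1" using drawing_norm_le[OF assms] by (simp add: power_le_one)
  then show ?thesis using hemi_sign_cases[of F e] by (auto simp: hemi_edge_def hemisphere_lift_def)
qed

context
  fixes F :: "'a set set"
  assumes pages: "noninterleaving c F" "noninterleaving c (chords - F)"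
begin

abbreviation p where "p \<equiv> hemi_vertex"
abbreviation g where "g \<equiv> hemi_edge F"

lemma same_sign_not_interleaved:
  assumes "e \<in> chords" "f \<in> chords" "hemi_sign F e = hemi_sign F f"
  shows "\<not> interleaved c e f"
proof (cases "e \<in> F")
  case True
  then have "f \<in> F" using assms(3) by (auto simp: hemi_sign_def split: if_splits)
  then show ?thesis using True pages(1) by (simp add: noninterleaving_def)
next
  case False
  then have "f \<notin> F" using assms(3) by (auto simp: hemi_sign_def split: if_splits)
  then have "e \<in> chords - F" "f \<in> chords - F" using False assms by auto
  then show ?thesis using pages(2) unfolding noninterleaving_def by blast
qed

lemma arc_hemi_edge: assumes e: "e \<in> E" shows "arc (g e)"
  unfolding arc_def path_def
proof
  show "continuous_on {0..1} (g e)"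
    unfolding hemi_edge_def by (intro continuous_on_compose drawing_continuous[OF e] continuous_hemisphere_lift)
  show "inj_on (g e) {0..1}"
  proof (rule inj_onI)
    fix s t assume st: "s \<in> {0..1::real}" "t \<in> {0..1}" "g e s = g e t"
    have "drawing e s = drawing e t" using arg_cong[OF st(3), of fst] by simp
    then show "s = t" using inj_onD[OF drawing_inj[OF e]] st by blast
  qed
qed

text \<open>Two distinct edges that meet off the equator are lifted to the same hemisphere and cross in the
  drawing. So they are interleaving chords of the same page, which is excluded. On the equator,
  edges meet only in common vertices.\<close>

lemma hemi_embedding: "graph_embedding V E sphere2 p g"
  unfolding graph_embedding_def
proof (intro conjI ballI impI)
  show "inj_on p V" using inj_pos by (auto simp: hemi_vertex_def inj_on_def)
  show "p ` V \<subseteq> sphere2" by (auto simp: hemi_vertex_def norm_Pair)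
next
  fix e assume e: "e \<in> E"
  show "arc (g e)" by (rule arc_hemi_edge[OF e])
  show "path_image (g e) \<subseteq> sphere2" using hemi_edge_sphere[OF e] by (auto simp: path_image_hemi_edge)
  have "cmod (drawing e 0) = 1" "cmod (drawing e 1) = 1" using drawing_end_vertex[OF e] norm_pos by metis+
  then have "{pathstart (g e), pathfinish (g e)} = (\<lambda>z. (z, 0)) ` {drawing e 0, drawing e 1}"
    by (simp add: pathstart_def pathfinish_def hemi_edge_on_circle)
  then show "{pathstart (g e), pathfinish (g e)} = p ` e"
    unfolding drawing_ends[OF e] by (simp add: image_image hemi_vertex_def)
next
  fix e u assume e: "e \<in> E" and u: "u \<in> V" "p u \<in> path_image (g e)"
  then obtain t where t: "t \<in> {0..1}" "p u = g e t" by (auto simp: path_image_hemi_edge)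
  have "fst (p u) = fst (g e t)" using t(2) by simp
  then have "pos u = drawing e t" by (simp only: hemi_vertex_def fst_conv fst_hemi_edge)
  then show "u \<in> e" using drawing_vertex[OF e u(1) t(1)] by blast
next
  fix e f assume ef: "e \<in> E" "f \<in> E" "e \<noteq> f"
  show "path_image (g e) \<inter> path_image (g f) \<subseteq> p ` (e \<inter> f)"
  proof
    fix x assume "x \<in> path_image (g e) \<inter> path_image (g f)"
    then obtain s t where st: "s \<in> {0..1}" "t \<in> {0..1}" "x = g e s" "x = g f t"
      by (auto simp: path_image_hemi_edge)
    then have eq: "drawing e s = drawing f t" by (metis fst_hemi_edge)
    show "x \<in> p ` (e \<inter> f)"
    proof (cases "cmod (drawing e s) = 1")
      case True
      then have "drawing e s \<in> pos ` (e \<inter> f)" by (rule drawing_meet_on_circle[OF ef st(1,2) eq])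
      moreover have "x = (drawing e s, 0)" using hemi_edge_on_circle[OF True] st by simp
      ultimately show ?thesis by (auto simp: hemi_vertex_def)
    next
      case False
      then have lt: "cmod (drawing e s) < 1" using drawing_norm_le[OF ef(1) st(1)] by simp
      then have ch: "e \<in> chords" "f \<in> chords" "interleaved c e f"
        using drawing_meet_inside[OF ef st(1,2) eq lt] by metis+
      have "sqrt (1 - (cmod (drawing e s))\<^sup>2) \<noteq> 0"
        using lt by (simp add: power2_eq_1_iff) (metis lt norm_ge_zero not_one_le_zero order_less_irrefl neg_0_le_iff_le)
      moreover have "hemi_sign F e * sqrt (1 - (cmod (drawing e s))\<^sup>2) = hemi_sign F f * sqrt (1 - (cmod (drawing e s))\<^sup>2)"
        using st eq by (metis (no_types, lifting) hemi_edge_def comp_apply hemisphere_lift_def prod.inject)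
      ultimately have "hemi_sign F e = hemi_sign F f" by simp
      then show ?thesis using same_sign_not_interleaved[OF ch(1,2)] ch(3) by blast
    qed
  qed
qed

lemma graph_image_hemi: "graph_image V E p g = (\<Union>e\<in>E. path_image (g e))"
proof -
  have "p u \<in> (\<Union>e\<in>E. path_image (g e))" if "u \<in> V" for u
    using vertex_on_spine[OF hemi_embedding that] spine_edges_subset unfolding cycle_image_def by blast
  then show ?thesis by (auto simp: graph_image_def)
qed

lemma graph_image_hemi_obtain:
  assumes "x \<in> graph_image V E p g"
  obtains e t where "e \<in> E" "t \<in> {0..1}" "x = g e t"
  using assms that unfolding graph_image_hemi path_image_hemi_edge by blast

lemma graph_image_hemi_sphere: "graph_image V E p g \<subseteq> sphere2"
  using graph_image_hemi_obtain hemi_edge_sphere by blast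

text \<open>The integer part of a position on the circle selects the edge of the spine that covers it.\<close>

lemma cycle_image_hemi: "cycle_image g c = {(z, 0) | z. cmod z = 1}"
proof (intro equalityI subsetI)
  fix x assume "x \<in> cycle_image g c"
  then obtain e t where "e \<in> cycle_edges c" "x = g e t" by (auto simp: cycle_image_def path_image_hemi_edge)
  then show "x \<in> {(z, 0) | z. cmod z = 1}"
    using drawing_cycle_norm hemi_edge_on_circle by auto
next
  fix x :: space3 assume "x \<in> {(z, 0) | z. cmod z = 1}"
  then obtain z where z: "x = (z, 0)" "cmod z = 1" by blast
  then obtain a where a: "0 \<le> a" "a < real n" "z = rim n a" using rim_surj[OF z(2) length_pos] by metis
  define k where "k = nat \<lfloor>a\<rfloor>"
  have k: "real k \<le> a" "a < real k + 1" using a unfolding k_def by linarith+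
  then have kn: "k < n" using a by linarith
  have mem: "step k \<in> cycle_edges c" by (rule step_in_spine)
  then obtain l where l: "l < n" "step k = step l" "drawing (step k) = (\<lambda>t. rim n (real l + t))" by (rule drawing_cycle)
  have "k = l" using step_inj[OF l(2), of 0] kn l by simp
  then have "drawing (step k) (a - real k) = z" using l a by simp
  then have "g (step k) (a - real k) = x" using hemi_edge_on_circle z by metis
  moreover have "a - real k \<in> {0..1}" using k by auto
  ultimately show "x \<in> cycle_image g c"
    unfolding cycle_image_def path_image_hemi_edge using mem by blast
qed

lemma hemi_crossing_points:
  assumes "x \<in> graph_image V E p g" "y \<in> graph_image V E p g" "x \<noteq> y" "fst x = fst y"
  obtains e f s t where "e \<in> E" "f \<in> E" "e \<noteq> f" "s \<in> {0..1}" "t \<in> {0..1}" "x = g e s" "y = g f t"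
    "drawing e s = drawing f t" "cmod (drawing e s) < 1" "fst x = drawing e s"
proof -
  obtain e s where e: "e \<in> E" "s \<in> {0..1}" "x = g e s" using graph_image_hemi_obtain[OF assms(1)] .
  obtain f t where f: "f \<in> E" "t \<in> {0..1}" "y = g f t" using graph_image_hemi_obtain[OF assms(2)] .
  have eq: "drawing e s = drawing f t" using assms e f by simp
  note * = hemi_edge_over[OF e(1) f(1) e(2) f(2) eq, of F]
  show ?thesis using that[OF e(1) f(1) _ e(2) f(2) e(3) f(3) eq] * assms(3) e f by simp
qed

section \<open>The hemisphere embedding as a leveled diagram\<close>

text \<open>Crossings are finite in number because two chords cross at most once; vertices lie on the
  equator, where the sphere has only one point on each vertical line.\<close>

lemma hemi_is_diagram: "is_diagram V E p g"
  unfolding is_diagram_def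
proof (intro conjI ballI impI)
  show "graph_embedding V E UNIV p g" by (rule graph_embedding_mono[OF hemi_embedding]) auto
next
  let ?X = "\<lambda>e f. {z. \<exists>s\<in>{0..1}. \<exists>t\<in>{0..1}. z = drawing f t \<and> drawing e s = drawing f t \<and> cmod (drawing e s) < 1}"
  have "finite (?X e f)" if "e \<in> E" "f \<in> E" "e \<noteq> f" for e f
  proof (cases "?X e f = {}")
    case True
    show ?thesis unfolding True by simp
  next
    case False
    then obtain z where "z \<in> ?X e f" by blast
    then obtain s t where st: "s \<in> {0..1}" "t \<in> {0..1}" "z = drawing f t" "drawing e s = drawing f t" "cmod (drawing e s) < 1"
      by auto
    have "?X e f \<subseteq> {z}"
    proof
      fix z' assume "z' \<in> ?X e f"
      then obtain s' t' where st': "s' \<in> {0..1}" "t' \<in> {0..1}" "z' = drawing f t'" "drawing e s' = drawing f t'" by auto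
      have "t = t'" by (rule drawing_meet_once[OF that st(1,2) st'(1,2) st(4) st'(4) st(5)])
      then show "z' \<in> {z}" using st st' by simp
    qed
    then show ?thesis by (rule finite_subset) simp
  qed
  note fin = this
  have "finite {(e, f). e \<in> E \<and> f \<in> E \<and> e \<noteq> f}"
    by (rule finite_subset[of _ "E \<times> E"]) (use finite_edges in auto)
  then have "finite (\<Union>(e, f)\<in>{(e, f). e \<in> E \<and> f \<in> E \<and> e \<noteq> f}. ?X e f)"
    by (rule finite_UN_I) (use fin in clarsimp)
  moreover have "{fst x | x y. x \<in> graph_image V E p g \<and> y \<in> graph_image V E p g \<and> x \<noteq> y \<and> fst x = fst y}
      \<subseteq> (\<Union>(e, f)\<in>{(e, f). e \<in> E \<and> f \<in> E \<and> e \<noteq> f}. ?X e f)"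
  proof
    fix z assume "z \<in> {fst x | x y. x \<in> graph_image V E p g \<and> y \<in> graph_image V E p g \<and> x \<noteq> y \<and> fst x = fst y}"
    then obtain x y where xy: "z = fst x" "x \<in> graph_image V E p g" "y \<in> graph_image V E p g" "x \<noteq> y" "fst x = fst y" by blast
    obtain e f s t where "e \<in> E" "f \<in> E" "e \<noteq> f" "s \<in> {0..1}" "t \<in> {0..1}"
      "drawing e s = drawing f t" "cmod (drawing e s) < 1" "fst x = drawing e s"
      using hemi_crossing_points[OF xy(2-5)] by metis
    then show "z \<in> (\<Union>(e, f)\<in>{(e, f). e \<in> E \<and> f \<in> E \<and> e \<noteq> f}. ?X e f)"
      using xy(1) by (intro UN_I[of "(e, f)"]) auto
  qed
  ultimately show "finite {fst x | x y. x \<in> graph_image V E p g \<and> y \<in> graph_image V E p g \<and> x \<noteq> y \<and> fst x = fst y}"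
    by (rule finite_subset[rotated])
next
  fix u x assume "u \<in> V" "x \<in> graph_image V E p g" "fst x = fst (p u)"
  then have "(snd x)\<^sup>2 = 0" "fst x = pos u"
    using sphere2_snd[of x] graph_image_hemi_sphere by (auto simp: hemi_vertex_def)
  then show "x = p u" by (simp add: hemi_vertex_def prod_eq_iff)
next
  fix x y z assume *: "x \<in> graph_image V E p g" "y \<in> graph_image V E p g" "z \<in> graph_image V E p g"
    "fst x = fst y \<and> fst y = fst z"
  then have S: "x \<in> sphere2" "y \<in> sphere2" "z \<in> sphere2" using graph_image_hemi_sphere by blast+
  show "x = y \<or> y = z \<or> x = z"
    using sphere2_fibre[OF S(1,2)] sphere2_fibre[OF S(1,3)] *(4) by (auto simp: prod_eq_iff)
next
  fix e f s t assume ef: "e \<in> E" "f \<in> E" and st: "s \<in> {0..1::real}" "t \<in> {0..1::real}"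
    and ne: "g e s \<noteq> g f t \<and> fst (g e s) = fst (g f t)"
  then have eq: "drawing e s = drawing f t" by simp
  note o = hemi_edge_over[OF ef st eq conjunct1[OF ne]]
  obtain i j k l where *: "i < j" "j < n" "k < l" "l < n"
    "drawing e = linepath (rim n (real i)) (rim n (real j))" "drawing f = linepath (rim n (real k)) (rim n (real l))"
    "(i < k \<and> k < j \<and> j < l) \<or> (k < i \<and> i < l \<and> l < j)" "0 < s" "s < 1" "0 < t" "t < 1"
    using drawing_meet_inside[OF ef o(2) st eq o(3)] by metis
  show "transversal (fst \<circ> g e) s (fst \<circ> g f) t"
    unfolding fst_comp_hemi_edge *(5,6)
    by (rule transversal_polygon_chords[OF *(1-4,7-11)]) (use eq *(5,6) in simp)
qed

lemma hemi_crosses_over: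
  assumes ef: "e \<in> E" "f \<in> E" and cross: "crosses_over (path_image (g e)) (path_image (g f))"
  shows "e \<notin> F" "f \<in> F"
proof -
  obtain s t where st: "s \<in> {0..1}" "t \<in> {0..1}" "drawing e s = drawing f t" "snd (g e s) > snd (g f t)"
    using cross by (auto simp: crosses_over_def path_image_hemi_edge)
  have "g e s \<noteq> g f t" using st(4) by auto
  then have ne: "hemi_sign F e \<noteq> hemi_sign F f" using hemi_edge_over[OF ef st(1-3)] by blast
  have "e \<notin> F \<and> f \<in> F"
  proof (rule ccontr)
    assume "\<not> ?thesis"
    then have "hemi_sign F e = -1" "hemi_sign F f = 1" using ne by (auto simp: hemi_sign_def split: if_splits)
    then show False using hemi_edge_snd_pos[OF ef(1) st(1), of F] hemi_edge_snd_pos[OF ef(2) st(2), of F] st(4) by simp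
  qed
  then show "e \<notin> F" "f \<in> F" by blast+
qed

lemma hemi_not_over_spine:
  assumes "A \<subseteq> graph_image V E p g"
  shows "\<not> crosses_over A (cycle_image g c)" "\<not> crosses_over (cycle_image g c) A"
proof -
  have "x = y" if "x \<in> A" "y \<in> cycle_image g c" "fst x = fst y" for x y
  proof -
    have y: "cmod (fst y) = 1" "snd y = 0" using that(2) unfolding cycle_image_hemi by auto
    have "x \<in> sphere2" using that(1) assms graph_image_hemi_sphere by blast
    then have "(snd x)\<^sup>2 = 0" using sphere2_snd[of x] y that(3) by simp
    then show ?thesis using y that by (simp add: prod_eq_iff)
  qed
  then show "\<not> crosses_over A (cycle_image g c)" "\<not> crosses_over (cycle_image g c) A"
    unfolding crosses_over_def by (metis less_irrefl)+
qed

text \<open>Inverse stereographic projection fixes the unit sphere of 3-space, so the spine already is the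
  equator of the model sphere.\<close>

lemma hemi_spine_unknotted: "unknotted (inv_stereographic ` cycle_image g c)"
proof -
  have "inv_stereographic (z, 0) = ((z, 0), 0)" if "cmod z = 1" for z
    using that by (simp add: inv_stereographic_def norm_Pair)
  then have "inv_stereographic ` cycle_image g c = {((z, 0), 0) | z. cmod z = 1}"
    unfolding cycle_image_hemi by force
  then show ?thesis unfolding unknotted_def using ambient_isotopy_end_id by (intro exI[of _ id]) simp
qed

text \<open>A move of type 1 needs a self-crossing of a projected edge, and one of type 2 needs two
  crossings of the same two edges. Straight chords have neither, and the spine is not crossed.\<close>

lemma hemi_reduced: "reduced V E p g"
  unfolding reduced_def
proof
  show "\<not> reducing_move_1 V E p g"
  proof
    assume "reducing_move_1 V E p g"
    then obtain e s t where "e \<in> E" "0 \<le> s" "s < t" "t \<le> 1" "fst (g e s) = fst (g e t)"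
      unfolding reducing_move_1_def by blast
    then show False using inj_onD[OF drawing_inj, of e s t] by simp
  qed
  show "\<not> reducing_move_2 V E p g"
  proof
    assume "reducing_move_2 V E p g"
    then obtain e f s t s' t' where ef: "e \<in> E" "f \<in> E"
      and st: "s \<in> {0..1}" "t \<in> {0..1}" "s' \<in> {0..1}" "t' \<in> {0..1}"
      and eq: "fst (g e s) = fst (g f s')" "snd (g e s) > snd (g f s')" "fst (g e t) = fst (g f t')"
      and a: "arc (subpath s' t' (fst \<circ> g f))"
      unfolding reducing_move_2_def Let_def by blast
    have eq': "drawing e s = drawing f s'" "drawing e t = drawing f t'" using eq by simp_all
    have "g e s \<noteq> g f s'" using eq(2) by auto
    note o = hemi_edge_over[OF ef st(1,3) eq'(1) this]
    have "s' = t'" by (rule drawing_meet_once[OF ef o(2) st(1,3,2,4) eq' o(3)])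
    then have "subpath s' t' (fst \<circ> g f) 0 = subpath s' t' (fst \<circ> g f) 1" by (simp add: subpath_def)
    then have "(0::real) = 1" using a unfolding arc_def by (elim conjE) (erule inj_onD, simp_all)
    then show False by simp
  qed
qed

lemma hemi_semi_leveled: "semi_leveled_diagram V E p g c"
proof -
  have emb: "graph_embedding V E UNIV p g" using hemi_is_diagram by (simp add: is_diagram_def)
  have frag: "\<And>A. A \<in> fragments V E p g c \<Longrightarrow> \<exists>e\<in>chords. A = path_image (g e)"
    using fragments_eq_chords[OF emb] by blast
  have AG: "path_image (g e) \<subseteq> graph_image V E p g" if "e \<in> chords" for e using that by (auto simp: graph_image_def)
  show ?thesis unfolding semi_leveled_diagram_def
  proof (intro conjI ballI impI)
    show "is_diagram V E p g" by (rule hemi_is_diagram)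
    show "is_cycle V E c" using ham by (simp add: hamiltonian_cycle_def)
    show "unknotted (inv_stereographic ` cycle_image g c)" by (rule hemi_spine_unknotted)
  next
    fix A assume "A \<in> fragments V E p g c"
    then obtain e where e: "e \<in> chords" "A = path_image (g e)" using frag by blast
    then have eE: "e \<in> E" by blast
    show "\<not> crosses_over A A" using hemi_crosses_over[OF eE eE] e by blast
    show "\<not> crosses_over A (cycle_image g c)" "\<not> crosses_over (cycle_image g c) A"
      using hemi_not_over_spine[OF AG[OF e(1)]] e by blast+
    fix B assume "B \<in> fragments V E p g c"
    then obtain f where f: "f \<in> chords" "B = path_image (g f)" using frag by blast
    then have fE: "f \<in> E" by blast
    show "\<not> (crosses_over A B \<and> crosses_over B A)"
      using hemi_crosses_over[OF eE fE] hemi_crosses_over[OF fE eE] e f by blast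
  qed
qed

lemma hemi_inside_spine:
  assumes "A \<in> fragments V E p g c"
  shows "fst ` (A - cycle_image g c) \<subseteq> inside (fst ` cycle_image g c)"
proof -
  have emb: "graph_embedding V E UNIV p g" using hemi_is_diagram by (simp add: is_diagram_def)
  obtain e where e: "e \<in> chords" "A = path_image (g e)" using assms fragments_eq_chords[OF emb] by blast
  have "fst ` cycle_image g c = frontier (cball 0 1)"
    unfolding cycle_image_hemi by (force simp: image_iff)
  then have ins: "inside (fst ` cycle_image g c) = ball 0 1"
    using inside_frontier_eq_interior[of "cball (0::complex) 1"] by simp
  show ?thesis
  proof
    fix z assume "z \<in> fst ` (A - cycle_image g c)"
    then have "z \<in> fst ` g e ` {0<..<1}" using chord_minus_spine[OF emb e(1)] e(2) by simp
    then obtain t where "0 < t" "t < 1" "z = drawing e t" by auto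
    then show "z \<in> inside (fst ` cycle_image g c)" unfolding ins using drawing_chord_norm[OF e(1)] by simp
  qed
qed

text \<open>The second level consists of the upper chords that do cross some other chord; the remaining
  upper chords cross nothing and count among the first level. With all chords on the lower page,
  nothing crosses and there is just one level.\<close>

lemma hemi_divided:
  "\<exists>m\<in>{1, 2}. divided_in_levels V E p g c m \<and> (chords \<subseteq> F \<longrightarrow> m = 1)"
proof -
  have emb: "graph_embedding V E UNIV p g" using hemi_is_diagram by (simp add: is_diagram_def)
  let ?Fr = "fragments V E p g c"
  note frag = fragments_eq_chords[OF emb]
  define L1 where "L1 = {A \<in> ?Fr. \<forall>B\<in>?Fr. B \<noteq> A \<longrightarrow> \<not> crosses_over A B}"
  define L where "L = (\<lambda>i::nat. if i = 1 then L1 else ?Fr - L1)"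
  have low: "path_image (g f) \<in> L1" if "f \<in> chords" "f \<in> F" for f
  proof -
    have "\<not> crosses_over (path_image (g f)) B" if B: "B \<in> ?Fr" for B
    proof
      assume cross: "crosses_over (path_image (g f)) B"
      obtain e where "e \<in> chords" "B = path_image (g e)" using B unfolding frag by blast
      then show False using hemi_crosses_over(1)[of f e] cross \<open>f \<in> F\<close> \<open>f \<in> chords\<close> by simp
    qed
    moreover have "path_image (g f) \<in> ?Fr" unfolding frag using that(1) by (rule imageI)
    ultimately show ?thesis unfolding L1_def by simp
  qed
  have over_low: "B \<in> L1" if AB: "A \<in> ?Fr" "B \<in> ?Fr" "crosses_over A B" for A B
  proof -
    obtain e where e: "e \<in> chords" "A = path_image (g e)" using AB(1) unfolding frag by blast
    obtain f where f: "f \<in> chords" "B = path_image (g f)" using AB(2) unfolding frag by blast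
    have "f \<in> F" using hemi_crosses_over(2)[of e f] AB(3) e f by simp
    then show ?thesis using low f by simp
  qed
  have L1_sub: "L1 \<subseteq> ?Fr" by (auto simp: L1_def)
  have L2: "?Fr - L1 = {A \<in> ?Fr. (\<exists>B\<in>L1. crosses_over A B) \<and> (\<forall>B\<in>?Fr. crosses_over A B \<longrightarrow> B \<in> L1)}" (is "_ = ?R")
  proof (intro equalityI subsetI)
    fix A assume A: "A \<in> ?Fr - L1"
    then obtain B where "B \<in> ?Fr" "crosses_over A B" unfolding L1_def by blast
    then show "A \<in> ?R" using A over_low by blast
  next
    fix A assume A: "A \<in> ?R"
    then obtain B where B: "B \<in> L1" "crosses_over A B" by blast
    have "\<not> crosses_over A A" using A hemi_semi_leveled unfolding semi_leveled_diagram_def by blast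
    then have "B \<noteq> A" using B by blast
    then have "A \<notin> L1" using B L1_sub unfolding L1_def by blast
    then show "A \<in> ?Fr - L1" using A by blast
  qed
  define m :: nat where "m = (if ?Fr \<subseteq> L1 then 1 else 2)"
  have "level_partition ?Fr m L"
  proof (cases "?Fr \<subseteq> L1")
    case True
    then have "m = 1" "L1 = ?Fr" using L1_sub by (auto simp: m_def)
    then show ?thesis
      unfolding level_partition_def by (simp add: L_def disjoint_family_on_def) (simp add: L1_def)
  next
    case False
    then have m: "m = 2" by (simp add: m_def)
    have sets: "{1..2::nat} = {1, 2}" "{2..2::nat} = {2}" "{1..<2::nat} = {1}" by auto
    show ?thesis
      unfolding level_partition_def m sets
    proof (intro conjI)
      show "\<Union> (L ` {1, 2}) = ?Fr" using L1_sub by (auto simp: L_def)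
      show "disjoint_family_on L {1, 2}" by (auto simp: disjoint_family_on_def L_def)
      show "\<forall>i\<in>{2}. L i \<noteq> {}" using False by (auto simp: L_def)
      show "L 1 = {A \<in> ?Fr. \<forall>B\<in>?Fr. B \<noteq> A \<longrightarrow> \<not> crosses_over A B}" by (simp add: L_def L1_def)
      have L_2: "L 2 = ?Fr - L1" "L (2 - 1) = L1" by (simp_all add: L_def)
      have ex: "(\<exists>k\<in>{1..<2}. B \<in> L k) \<longleftrightarrow> B \<in> L1" for B unfolding sets by (simp add: L_def)
      have "L 2 = {A \<in> ?Fr. (\<exists>B\<in>L (2 - 1). crosses_over A B) \<and>
                               (\<forall>B\<in>?Fr. crosses_over A B \<longrightarrow> (\<exists>k\<in>{1..<2}. B \<in> L k))}"
        unfolding L_2 ex by (rule L2)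
      then show "\<forall>i\<in>{2}. L i = {A \<in> ?Fr. (\<exists>B\<in>L (i - 1). crosses_over A B) \<and>
                               (\<forall>B\<in>?Fr. crosses_over A B \<longrightarrow> (\<exists>k\<in>{1..<i}. B \<in> L k))}"
        by blast
    qed simp
  qed
  moreover have "\<not> crosses_over (cycle_image g c) (cycle_image g c)"
    by (rule hemi_not_over_spine(1)) (use spine_edges_subset in \<open>auto simp: cycle_image_def graph_image_def\<close>)
  ultimately have "divided_in_levels V E p g c m"
    unfolding divided_in_levels_def using hemi_semi_leveled hemi_reduced hemi_inside_spine by blast
  moreover have "m = 1" if "chords \<subseteq> F"
  proof -
    have "?Fr \<subseteq> L1" using low that unfolding frag by blast
    then show ?thesis by (simp add: m_def)
  qed
  ultimately show ?thesis by (intro bexI[of _ m]) (auto simp: m_def)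
qed

text \<open>With all chords on the lower page, the open upper hemisphere is a component of the complement:
  it is bounded by the equator, which the spine covers. All vertices lie on the equator.\<close>

lemma hemi_outerplanar:
  assumes "chords \<subseteq> F" shows "outerplanar V E"
proof -
  define R where "R = {x \<in> sphere2. snd x > 0}"
  have G: "snd x \<le> 0" if "x \<in> graph_image V E p g" for x
  proof -
    obtain e t where e: "e \<in> E" "t \<in> {0..1}" "x = g e t" using \<open>x \<in> _\<close> by (rule graph_image_hemi_obtain)
    show ?thesis
    proof (cases "e \<in> cycle_edges c")
      case True
      then show ?thesis using hemi_edge_on_circle[OF drawing_cycle_norm] e by simp
    next
      case False
      then have "hemi_sign F e = -1" using assms e by (auto simp: hemi_sign_def)
      then show ?thesis using hemi_edge_snd_pos[OF e(1,2), of F] e(3) by simp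
    qed
  qed
  have R_eq: "R = hemisphere_lift 1 ` ball 0 1"
  proof (intro equalityI subsetI)
    fix x assume x: "x \<in> R"
    then have s: "(snd x)\<^sup>2 = 1 - (cmod (fst x))\<^sup>2" "snd x > 0" using sphere2_snd[of x] by (auto simp: R_def)
    then have "snd x = sqrt (1 - (cmod (fst x))\<^sup>2)" by (metis less_imp_le real_sqrt_unique)
    then have "x = hemisphere_lift 1 (fst x)" by (simp add: hemisphere_lift_def prod_eq_iff)
    moreover have "(cmod (fst x))\<^sup>2 < 1\<^sup>2" using s zero_less_power[OF s(2), of 2] by simp
    then have "cmod (fst x) < 1" by (rule power2_less_imp_less) simp
    ultimately show "x \<in> hemisphere_lift 1 ` ball 0 1" by auto
  next
    fix x assume "x \<in> hemisphere_lift 1 ` ball 0 1"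
    then obtain z where z: "cmod z < 1" "x = hemisphere_lift 1 z" by auto
    have "(cmod z)\<^sup>2 < 1" using z(1) by (simp add: power_less_one_iff)
    then show "x \<in> R" using z hemisphere_lift_in_sphere[of z 1] by (simp add: R_def) (simp add: hemisphere_lift_def)
  qed
  have conR: "connected R" unfolding R_eq
    by (intro connected_continuous_image continuous_hemisphere_lift convex_connected convex_ball)
  have eq: "x \<in> graph_image V E p g" if "x \<in> sphere2" "snd x = 0" for x
  proof -
    have "(cmod (fst x))\<^sup>2 = 1\<^sup>2" using sphere2_snd[OF that(1)] that(2) by simp
    then have "cmod (fst x) = 1" by (rule power2_eq_imp_eq) simp_all
    then have "x \<in> cycle_image g c" using that(2) unfolding cycle_image_hemi by (cases x) auto
    then show ?thesis using spine_edges_subset by (auto simp: cycle_image_def graph_image_def)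
  qed
  have "R \<in> components (sphere2 - graph_image V E p g)"
    unfolding in_components_maximal
  proof (intro conjI allI impI)
    show "R \<noteq> {}" unfolding R_eq by simp
    show "R \<subseteq> sphere2 - graph_image V E p g" using G by (force simp: R_def)
    show "connected R" by (rule conR)
    fix T assume T: "T \<noteq> {} \<and> R \<subseteq> T \<and> T \<subseteq> sphere2 - graph_image V E p g \<and> connected T"
    have op: "open {x::space3. snd x > 0}" "open {x::space3. snd x < 0}"
      by (intro open_Collect_less continuous_intros)+
    have cover: "T \<subseteq> {x. snd x > 0} \<union> {x. snd x < 0}"
    proof
      fix x assume x: "x \<in> T"
      then have "snd x \<noteq> 0" using T eq[of x] by blast
      then show "x \<in> {x. snd x > 0} \<union> {x. snd x < 0}" by auto
    qed
    have "{x. snd x > 0} \<inter> T = {} \<or> {x. snd x < 0} \<inter> T = {}"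
      by (rule connectedD[OF _ op]) (use T cover in auto)
    moreover have "{x. snd x > 0} \<inter> T \<noteq> {}"
    proof -
      have "hemisphere_lift 1 0 \<in> R" unfolding R_eq by simp
      then show ?thesis using T by (auto simp: R_def)
    qed
    ultimately have "T \<subseteq> {x. snd x > 0}" using cover by blast
    then have "T \<subseteq> R" using T by (auto simp: R_def)
    then show "T = R" using T by blast
  qed
  moreover have "p ` V \<subseteq> top_of_set sphere2 frontier_of R"
  proof
    fix x assume "x \<in> p ` V"
    then obtain u where u: "u \<in> V" "x = p u" by blast
    have "hemisphere_lift 1 ` closure (ball 0 1) \<subseteq> closure (hemisphere_lift 1 ` ball 0 1)"
      by (rule image_closure_subset[OF continuous_hemisphere_lift closed_closure closure_subset])
    moreover have "x = hemisphere_lift 1 (pos u)" using u by (simp add: hemi_vertex_def hemisphere_lift_rim)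
    moreover have "pos u \<in> closure (ball 0 1)" by simp
    ultimately have "x \<in> closure R" unfolding R_eq by blast
    moreover have xS: "x \<in> sphere2" using u by (simp add: hemi_vertex_def norm_Pair)
    moreover have "R \<subseteq> sphere2" by (auto simp: R_def)
    ultimately have "x \<in> top_of_set sphere2 closure_of R"
      by (simp add: closure_of_subtopology Int_absorb1)
    moreover have "x \<notin> R" using u by (simp add: R_def hemi_vertex_def)
    then have "x \<notin> top_of_set sphere2 interior_of R" using subsetD[OF interior_of_subset[of _ R]] by metis
    ultimately show "x \<in> top_of_set sphere2 frontier_of R" by (simp add: frontier_of_def)
  qed
  ultimately show ?thesis unfolding outerplanar_def using hemi_embedding by blast
qed

end

lemma two_page_planar:
  assumes "noninterleaving c F" "noninterleaving c (chords - F)" shows "planar V E"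
  unfolding planar_def using hemi_embedding[OF assms] by blast

lemma two_page_two_levels:
  assumes "noninterleaving c F" "noninterleaving c (chords - F)"
  shows "\<exists>p g m. m \<le> 2 \<and> divided_in_levels V E p g c m"
proof -
  obtain m where m: "m \<in> {1, 2}" "divided_in_levels V E hemi_vertex (hemi_edge F) c m"
    using hemi_divided[OF assms] by blast
  have "m \<le> 2" using m(1) by auto
  then show ?thesis using m(2) by blast
qed

lemma one_page_remainder: "noninterleaving c (chords - chords)"
  unfolding Diff_cancel by (simp add: noninterleaving_def)

lemma one_page_outerplanar:
  assumes "noninterleaving c chords" shows "outerplanar V E"
  by (rule hemi_outerplanar[OF assms one_page_remainder order_refl])

lemma one_page_one_level:
  assumes "noninterleaving c chords" shows "\<exists>p g. divided_in_levels V E p g c 1"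
proof -
  obtain m where "divided_in_levels V E hemi_vertex (hemi_edge chords) c m" "chords \<subseteq> chords \<longrightarrow> m = 1"
    using hemi_divided[OF assms one_page_remainder] by blast
  then have "divided_in_levels V E hemi_vertex (hemi_edge chords) c 1" by simp
  then show ?thesis by (intro exI)
qed

end

section \<open>Planarity and the Hamiltonian level number\<close>

theorem proposition4:
  fixes V :: "'a set" and E :: "'a set set"
  assumes "simple_graph V E" and "connected_graph V E" and "hamiltonian V E"
  shows "(planar V E \<longleftrightarrow> hamiltonian_level_number V E \<le> 2) \<and>
         (outerplanar V E \<longleftrightarrow> hamiltonian_level_number V E = 1)"
proof
  have spine: "spine_graph V E c" if "hamiltonian_cycle V E c" for c
    using assms(1) that by unfold_locales
  obtain c where c: "hamiltonian_cycle V E c" using assms(3) by (auto simp: hamiltonian_def)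
  show "planar V E \<longleftrightarrow> hamiltonian_level_number V E \<le> 2"
  proof
    assume "planar V E"
    then obtain F where F: "noninterleaving c F" "noninterleaving c (E - cycle_edges c - F)"
      using spine_graph.planar_two_page[OF spine[OF c]] by blast
    then have "hamiltonian_level_number V E \<le> enat 2"
      unfolding hamiltonian_level_number_le_iff
      using spine_graph.two_page_two_levels[OF spine[OF c] F] c by blast
    then show "hamiltonian_level_number V E \<le> 2" by (simp add: numeral_eq_enat)
  next
    assume "hamiltonian_level_number V E \<le> 2"
    then have "hamiltonian_level_number V E \<le> enat 2" by (simp add: numeral_eq_enat)
    then obtain c p g m where c: "hamiltonian_cycle V E c" and m: "m \<le> 2" "divided_in_levels V E p g c m"
      unfolding hamiltonian_level_number_le_iff by blast
    then show "planar V E"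
      using spine_graph.two_levels_two_page[OF spine[OF c] m(2,1)] spine_graph.two_page_planar[OF spine[OF c]] by blast
  qed
  show "outerplanar V E \<longleftrightarrow> hamiltonian_level_number V E = 1"
  proof
    assume "outerplanar V E"
    then have "noninterleaving c (E - cycle_edges c)" by (rule spine_graph.outerplanar_one_page[OF spine[OF c]])
    then obtain p g where "divided_in_levels V E p g c 1"
      using spine_graph.one_page_one_level[OF spine[OF c]] by blast
    then have "hamiltonian_level_number V E \<le> enat 1"
      unfolding hamiltonian_level_number_le_iff using c by blast
    then show "hamiltonian_level_number V E = 1"
      using hamiltonian_level_number_ge_1[of V E] by (simp add: one_enat_def)
  next
    assume "hamiltonian_level_number V E = 1"
    then have "hamiltonian_level_number V E \<le> enat 1" by (simp add: one_enat_def)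
    then obtain c p g m where c: "hamiltonian_cycle V E c" and m: "m \<le> 1" "divided_in_levels V E p g c m"
      unfolding hamiltonian_level_number_le_iff by blast
    have "m \<ge> 1" using m(2) unfolding divided_in_levels_def level_partition_def by blast
    then have "divided_in_levels V E p g c 1" using m by simp
    then show "outerplanar V E"
      using spine_graph.one_level_one_page[OF spine[OF c]] spine_graph.one_page_outerplanar[OF spine[OF c]] by blast
  qed
qed

end
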